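(* Let $S_g$ be a closed, oriented surface of genus $g\ge 2$ with a curve system $\mathcal{L}=\{[\gamma_1],\ldots,[\gamma_{3g-3}]\}$ and pairs of pants $Y_1,\ldots,Y_{2g-2}$. Let $\rho\in\mathcal{Q}(S_g,\mathcal{L},\mathrm{SL}(3,\mathbb{R}))$, write $\Gamma=\rho(\pi_1(S_g))$ and $A_j=\rho([\gamma_j])$. Then $\Gamma$ (that is, the representation $\rho$) is determined up to conjugation by (1) the traces $\mathrm{tr}(A_1),\ldots,\mathrm{tr}(A_{3g-3})$ and $\mathrm{tr}(A_1^{-1}),\ldots,\mathrm{tr}(A_{3g-3}^{-1})$; (2) the shape invariants $\sigma_+(Y_1),\ldots,\sigma_+(Y_{2g-2})$ and $\sigma_-(Y_1),\ldots,\sigma_-(Y_{2g-2})$; (3) the choice of a root of each of the commutator equations $Q(Y_1),\ldots,Q(Y_{2g-2})$; (4) the twists $t_\Gamma(\gamma_1),\ldots,t_\Gamma(\gamma_{3g-3})$ and the bulges $s_\Gamma(\gamma_1),\ldots,s_\Gamma(\gamma_{3g-3})$. That is, two representations in $\mathcal{Q}(S_g,\mathcal{L},\mathrm{SL}(3,\mathbb{R}))$ for which all the data (1)-(4) agree are conjugate.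
   Context: Surface. A curve system on $S_g$ is a maximal set $\mathcal{L}=\{[\gamma_1],\ldots,[\gamma_{3g-3}]\}$ of distinct non-trivial homotopy classes of simple closed curves having simple, pairwise disjoint representatives $\gamma_j$. The set $S_g\setminus\bigcup_j\gamma_j$ is a disjoint union of $2g-2$ pairs of pants (three-holed spheres) $Y_1,\ldots,Y_{2g-2}$; each $\gamma_j$ is a boundary curve of precisely two pairs of pants, or corresponds to two different boundary curves of the same pair of pants. Write $\pi_1(Y_k)=\langle \alpha_k,\beta_k,\delta_k : \delta_k\beta_k\alpha_k=1\rangle$, the generators corresponding to the three oriented boundary curves. Fix a spanning tree of the graph with vertices $Y_k$ and edges $\gamma_j$. Each $\gamma_j$ corresponds to two boundary generators, with opposite orientations: $a_j\in\pi_1(Y_{k})$, representing $[\gamma_j]$, and $a_j'\in\pi_1(Y_{k'})$ (with $k=k(j)$, $k'=k'(j)$, possibly equal). Then $\pi_1(S_g)$ is generated by the groups $\pi_1(Y_k)$ and elements $d_1,\ldots,d_{3g-3}$, subject to $a_j'=d_ja_j^{-1}d_j^{-1}$ for all $j$ and $d_j=1$ whenever $\gamma_j$ is in the spanning tree. Quasi-Fuchsian space. An element of $\mathrm{SL}(3,\mathbb{C})$ is strongly loxodromic if its eigenvalues have pairwise different absolute values. Let $J$ be the $3\times3$ antidiagonal matrix with all antidiagonal entries $1$ (signature $(2,1)$); $\mathrm{SO}_0(2,1)$ means the identity component of $\mathrm{SO}(J;\mathbb{R})$. A Fuchsian representation is an irreducible, discrete, faithful, totally loxodromic representation $\pi_1(S_g)\to\mathrm{SO}_0(2,1)$.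 For $\mathrm{SO}_0(2,1)<G<\mathrm{SL}(3,\mathbb{C})$, $\mathcal{Q}(S_g,\mathcal{L},G)$ is the collection of $\mathrm{SL}(3,\mathbb{C})$-conjugacy classes of representations $\rho:\pi_1(S_g)\to G$ that are discrete, faithful and totally strongly loxodromic (every non-trivial element maps to a strongly loxodromic one), and that can be connected to a Fuchsian representation by a path of such representations; it contains all Fuchsian representations. As in the paper, $\mathcal{Q}(S_g,\mathcal{L},G)$ is regarded as a subset of the space $\mathcal{Y}(S_g,\mathcal{L})$ of conjugacy classes of representations $\rho:\pi_1(S_g)\to \mathrm{SL}(3,\mathbb{C})$ such that each $\rho([\gamma_j])$ is strongly loxodromic and each restriction $\rho|_{\pi_1(Y_k)}$ is irreducible. Pants data. For $A=\rho(\alpha_k)$, $B=\rho(\beta_k)$, $C=\rho(\delta_k)$ (so $CBA=I$) the shape invariants are $$\sigma_+(Y_k)=\mathrm{tr}(A^{-1}B)-\mathrm{tr}(A^{-1})\mathrm{tr}(B),\qquad \sigma_-(Y_k)=\mathrm{tr}(B^{-1}A)-\mathrm{tr}(B^{-1})\mathrm{tr}(A).$$ The commutator equation $Q(Y_k)$ is $X^2-SX+P=0$ with $S=\mathrm{tr}[A,B]+\mathrm{tr}[B,A]$ and $P=\mathrm{tr}[A,B]\,\mathrm{tr}[B,A]$, where $[A,B]=ABA^{-1}B^{-1}$; by a theorem of Lawton, $S$ and $P$ are universal polynomials in $\mathrm{tr}(A^{\pm1}),\mathrm{tr}(B^{\pm1}),\mathrm{tr}(C^{\pm1}),\sigma_\pm(Y_k)$,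 and the choice of a root means the specification of which root is $\mathrm{tr}[A,B]$. An irreducible representation of $\pi_1(Y_k)$ to $\mathrm{SL}(3,\mathbb{C})$ is determined up to conjugation by these eight quantities and this choice of root. Twist and bulge. Put $G=\mathrm{SL}(3,\mathbb{R})$. For each value of the data (1)-(3) attained in $\mathcal{Q}(S_g,\mathcal{L},G)$ fix once and for all a reference representation $\rho^0:\pi_1(S_g)\to G$ in $\mathcal{Q}(S_g,\mathcal{L},G)$ with this data. If $\rho$ has the same data (1)-(3), choose $g_k\in \mathrm{SL}(3,\mathbb{R})$ with $\rho|_{\pi_1(Y_k)}=g_k\,\rho^0|_{\pi_1(Y_k)}\,g_k^{-1}$. For each $j$ there is $K_j\in G$ in the centraliser of $\rho^0(a_j)$ describing the gluing of $\rho$ along $\gamma_j$ relative to $\rho^0$: for $\gamma_j$ in the spanning tree, $g_k^{-1}g_{k'}=K_j$; otherwise $g_{k'}^{-1}\rho(d_j)g_k=\rho^0(d_j)K_j$. Let $\kappa_1,\kappa_2,\kappa_3$ be the eigenvalues of $K_j$ on the eigenvectors of $\rho^0(a_j)$ for its eigenvalues of largest, middle and smallest absolute value. Write $\kappa_2=e^{2v}$, $\kappa_1=e^{u-v}$, with $u=(t+i\theta)_\Gamma(\gamma_j)$ ($\theta\in\mathbb{R}/2\pi\mathbb{Z}$) and $v=(s+i\phi)_\Gamma(\gamma_j)$ ($\phi\in\mathbb{R}/\pi\mathbb{Z}$). The twist is $t_\Gamma(\gamma_j)=\mathrm{Re}(u)$ and the bulge is $s_\Gamma(\gamma_j)=\mathrm{Re}(v)$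 (in the setting of this theorem the bend $\theta$ and the turn $\phi$ are zero, so $\kappa_1=e^{t-s}$, $\kappa_2=e^{2s}$, $\kappa_3=e^{-t-s}$). *)

theory Defs
  imports
    "HOL-Homology.Homology"
    "HOL-Analysis.Analysis"
    "HOL-Computational_Algebra.Polynomial"
begin

section \<open>The fundamental group\<close>

definition path_class :: "'a::topological_space set \<Rightarrow> (real \<Rightarrow> 'a) \<Rightarrow> (real \<Rightarrow> 'a) set" where
  "path_class X p = {q. homotopic_paths X p q}"

definition loops_at :: "'a::topological_space set \<Rightarrow> 'a \<Rightarrow> (real \<Rightarrow> 'a) set" where
  "loops_at X x = {p. path p \<and> path_image p \<subseteq> X \<and> pathstart p = x \<and> pathfinish p = x}"

definition pi1 :: "'a::topological_space set \<Rightarrow> 'a \<Rightarrow> (real \<Rightarrow> 'a) set monoid" where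
  "pi1 X x =
    \<lparr>carrier = path_class X ` loops_at X x,
     monoid.mult = (\<lambda>a b. {r. \<exists>p\<in>a. \<exists>q\<in>b. homotopic_paths X (p +++ q) r}),
     one = path_class X (\<lambda>_. x)\<rparr>"

lemma path_class_eqI: "homotopic_paths X p q \<Longrightarrow> path_class X p = path_class X q"
  unfolding path_class_def using homotopic_paths_sym homotopic_paths_trans by blast

lemma path_class_eq_iff:
  assumes "p \<in> loops_at X x"
  shows "path_class X p = path_class X q \<longleftrightarrow> homotopic_paths X p q"
proof
  assume "path_class X p = path_class X q"
  moreover have "p \<in> path_class X p"
    using assms by (simp add: path_class_def loops_at_def)
  ultimately show "homotopic_paths X p q"
    by (simp add: path_class_def homotopic_paths_sym)
qed (rule path_class_eqI)

lemma loops_at_join: "p \<in> loops_at X x \<Longrightarrow> q \<in> loops_at X x \<Longrightarrow> p +++ q \<in> loops_at X x"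
  by (auto simp: loops_at_def path_image_join)

lemma pi1_mult:
  assumes "p \<in> loops_at X x" "q \<in> loops_at X x"
  shows "path_class X p \<otimes>\<^bsub>pi1 X x\<^esub> path_class X q = path_class X (p +++ q)"
proof -
  have "homotopic_paths X (p +++ q) r"
    if h: "homotopic_paths X p p'" "homotopic_paths X q q'" "homotopic_paths X (p' +++ q') r"
    for p' q' r
  proof -
    have "homotopic_paths X (p +++ q) (p' +++ q')"
      by (rule homotopic_paths_join[OF h(1,2)]) (use assms in \<open>auto simp: loops_at_def\<close>)
    then show ?thesis
      using h(3) homotopic_paths_trans by blast
  qed
  moreover have pq: "homotopic_paths X p p" "homotopic_paths X q q"
    using assms by (auto simp: loops_at_def)
  ultimately have "(\<exists>p'\<in>path_class X p. \<exists>q'\<in>path_class X q. homotopic_paths X (p' +++ q') r)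
      \<longleftrightarrow> r \<in> path_class X (p +++ q)" for r
    unfolding path_class_def mem_Collect_eq Bex_def by (meson pq)
  then show ?thesis
    by (simp add: pi1_def set_eq_iff)
qed

lemma homotopic_paths_const_right:
  assumes "path p" "path_image p \<subseteq> X"
  shows "homotopic_paths X (p +++ (\<lambda>_. pathfinish p)) p"
proof (rule homotopic_paths_sym, rule homotopic_paths_reparametrize[where f = "\<lambda>t. min (2 * t) 1"])
  show "continuous_on {0..1} (\<lambda>t::real. min (2 * t) 1)"
    by (intro continuous_intros)
  show "(p +++ (\<lambda>_. pathfinish p)) t = p (min (2 * t) 1)" if "t \<in> {0..1}" for t
    using that by (auto simp: joinpaths_def pathfinish_def min_def)
qed (use assms in auto)

lemma homotopic_paths_const_left:
  assumes "path p" "path_image p \<subseteq> X"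
  shows "homotopic_paths X ((\<lambda>_. pathstart p) +++ p) p"
proof (rule homotopic_paths_sym, rule homotopic_paths_reparametrize[where f = "\<lambda>t. max (2 * t - 1) 0"])
  show "continuous_on {0..1} (\<lambda>t::real. max (2 * t - 1) 0)"
    by (intro continuous_intros)
  show "((\<lambda>_. pathstart p) +++ p) t = p (max (2 * t - 1) 0)" if "t \<in> {0..1}" for t
    using that by (auto simp: joinpaths_def pathstart_def max_def)
qed (use assms in auto)

lemma homotopic_paths_reverse_join:
  assumes "path p" "path_image p \<subseteq> X"
  shows "homotopic_paths X (reversepath p +++ p) (\<lambda>_. pathfinish p)"
proof -
  define h where "h = (\<lambda>y::real \<times> real. p (1 - (1 - fst y) * (1 - \<bar>2 * snd y - 1\<bar>)))"
  have rng: "0 \<le> 1 - (1 - s) * (1 - \<bar>2 * t - 1\<bar>) \<and> 1 - (1 - s) * (1 - \<bar>2 * t - 1\<bar>) \<le> 1"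
    if "s \<in> {0..1}" "t \<in> {0..1}" for s t :: real
  proof -
    have "0 \<le> 1 - s" "1 - s \<le> 1" "0 \<le> 1 - \<bar>2 * t - 1\<bar>" "1 - \<bar>2 * t - 1\<bar> \<le> 1"
      using that by auto
    then show ?thesis
      by (simp add: mult_le_one)
  qed
  have "continuous_on ({0..1} \<times> {0..1}) h"
    unfolding h_def
    by (rule continuous_on_compose2[of "{0..1}" p])
       (use assms rng in \<open>auto simp: path_def intro!: continuous_intros\<close>)
  moreover have "h \<in> ({0..1} \<times> {0..1}) \<rightarrow> X"
    using assms rng by (auto simp: h_def path_image_def)
  moreover have "h (0, t) = (reversepath p +++ p) t" for t
  proof -
    have "\<bar>2 * t - 1\<bar> = (if t \<le> 1/2 then 1 - 2 * t else 2 * t - 1)"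
      by auto
    then show ?thesis
      by (simp add: h_def joinpaths_def reversepath_def)
  qed
  ultimately show ?thesis
    unfolding homotopic_paths
    by (intro exI[of _ h]) (auto simp: h_def pathstart_def pathfinish_def joinpaths_def reversepath_def)
qed

lemma group_pi1:
  assumes "x \<in> X"
  shows "group (pi1 X x)"
proof (rule groupI)
  have c: "(\<lambda>_. x) \<in> loops_at X x"
    using assms by (auto simp: loops_at_def path_def path_image_def pathstart_def pathfinish_def)
  then show "\<one>\<^bsub>pi1 X x\<^esub> \<in> carrier (pi1 X x)"
    by (auto simp: pi1_def)
  have car: "carrier (pi1 X x) = path_class X ` loops_at X x"
    and one: "\<one>\<^bsub>pi1 X x\<^esub> = path_class X (\<lambda>_. x)"
    by (simp_all add: pi1_def)
  show "a \<otimes>\<^bsub>pi1 X x\<^esub> b \<in> carrier (pi1 X x)"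
    if "a \<in> carrier (pi1 X x)" "b \<in> carrier (pi1 X x)" for a b
    using that by (auto simp: car pi1_mult intro!: imageI loops_at_join)
  show "a \<otimes>\<^bsub>pi1 X x\<^esub> b \<otimes>\<^bsub>pi1 X x\<^esub> c = a \<otimes>\<^bsub>pi1 X x\<^esub> (b \<otimes>\<^bsub>pi1 X x\<^esub> c)"
    if prems: "a \<in> carrier (pi1 X x)" "b \<in> carrier (pi1 X x)" "c \<in> carrier (pi1 X x)" for a b c
  proof -
    obtain p q r where l: "p \<in> loops_at X x" "q \<in> loops_at X x" "r \<in> loops_at X x"
      and eq: "a = path_class X p" "b = path_class X q" "c = path_class X r"
      using prems unfolding car by blast
    have "homotopic_paths X (p +++ (q +++ r)) ((p +++ q) +++ r)"
      by (rule homotopic_paths_assoc) (use l in \<open>auto simp: loops_at_def\<close>)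
    then show ?thesis
      using l by (simp add: eq pi1_mult loops_at_join path_class_eqI)
  qed
  show "\<one>\<^bsub>pi1 X x\<^esub> \<otimes>\<^bsub>pi1 X x\<^esub> a = a" if prems: "a \<in> carrier (pi1 X x)" for a
  proof -
    obtain p where l: "p \<in> loops_at X x" and eq: "a = path_class X p"
      using prems by (auto simp: car)
    have "homotopic_paths X ((\<lambda>_. x) +++ p) p"
      using homotopic_paths_const_left[of p X] l by (auto simp: loops_at_def)
    then show ?thesis
      using l c by (simp add: eq one pi1_mult path_class_eqI)
  qed
  show "\<exists>b\<in>carrier (pi1 X x). b \<otimes>\<^bsub>pi1 X x\<^esub> a = \<one>\<^bsub>pi1 X x\<^esub>" if prems: "a \<in> carrier (pi1 X x)" for a
  proof -
    obtain p where l: "p \<in> loops_at X x" and eq: "a = path_class X p"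
      using prems by (auto simp: car)
    have r: "reversepath p \<in> loops_at X x"
      using l by (auto simp: loops_at_def)
    have "homotopic_paths X (reversepath p +++ p) (\<lambda>_. x)"
      using homotopic_paths_reverse_join[of p X] l by (auto simp: loops_at_def)
    then show ?thesis
      using l r by (intro bexI[of _ "path_class X (reversepath p)"])
        (simp_all add: eq one car pi1_mult path_class_eqI)
  qed
qed

section \<open>Group presentations\<close>

text \<open>A word is a list of letters \<open>(i, e)\<close>; the letter stands for the generator \<open>i\<close> if \<open>e\<close> is
  true and for its inverse otherwise.\<close>

definition word_val ::
    "('g, 'm) monoid_scheme \<Rightarrow> ('i \<Rightarrow> 'g) \<Rightarrow> ('i \<times> bool) list \<Rightarrow> 'g" where
  "word_val G x w = foldr (\<lambda>(i, e) h. (if e then x i else inv\<^bsub>G\<^esub> (x i)) \<otimes>\<^bsub>G\<^esub> h) w \<one>\<^bsub>G\<^esub>"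

inductive elementary_move ::
    "'i set \<Rightarrow> ('i \<times> bool) list set \<Rightarrow> ('i \<times> bool) list \<Rightarrow> ('i \<times> bool) list \<Rightarrow> bool"
  for I R where
    cancel: "i \<in> I \<Longrightarrow> elementary_move I R (u @ [(i, e), (i, \<not> e)] @ v) (u @ v)"
  | relator: "r \<in> R \<Longrightarrow> elementary_move I R (u @ r @ v) (u @ v)"

definition presented_by ::
    "('g, 'm) monoid_scheme \<Rightarrow> 'i set \<Rightarrow> ('i \<Rightarrow> 'g) \<Rightarrow> ('i \<times> bool) list set \<Rightarrow> bool" where
  "presented_by G I x R \<longleftrightarrow>
     x ` I \<subseteq> carrier G \<and>
     carrier G = word_val G x ` lists (I \<times> UNIV) \<and>
     (\<forall>w\<in>lists (I \<times> UNIV). word_val G x w = \<one>\<^bsub>G\<^esub> \<longleftrightarrow> equivclp (elementary_move I R) w [])"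

section \<open>Closed surfaces and curve systems\<close>

text \<open>A compact connected 2-manifold; orientability and the genus are read off its integral
  homology.  Neither orientation of the surface is singled out.\<close>

definition closed_oriented_surface :: "nat \<Rightarrow> 'a::t2_space set \<Rightarrow> bool" where
  "closed_oriented_surface g S \<longleftrightarrow>
     compact S \<and> connected S \<and>
     (\<forall>x\<in>S. \<exists>U. openin (top_of_set S) U \<and> x \<in> U \<and> U homeomorphic (ball 0 1 :: (real^2) set)) \<and>
     homology_group 2 (top_of_set S) \<cong> integer_group \<and>
     homology_group 1 (top_of_set S) \<cong> free_Abelian_group {..<2 * g}"

definition simple_closed_curve :: "'a::topological_space set \<Rightarrow> (real \<Rightarrow> 'a) \<Rightarrow> bool" where
  "simple_closed_curve S c \<longleftrightarrow>
     simple_path c \<and> path_image c \<subseteq> S \<and> pathfinish c = pathstart c"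

definition nontrivial_curve :: "'a::topological_space set \<Rightarrow> (real \<Rightarrow> 'a) \<Rightarrow> bool" where
  "nontrivial_curve S c \<longleftrightarrow> \<not> (\<exists>x. homotopic_loops S c (\<lambda>_. x))"

text \<open>Curves in a curve system carry no orientation: a curve and its reverse are in the same
  class.  Otherwise a maximal system would contain every curve twice.\<close>

definition curve_class :: "'a::topological_space set \<Rightarrow> (real \<Rightarrow> 'a) \<Rightarrow> (real \<Rightarrow> 'a) set" where
  "curve_class S c = {c'. homotopic_loops S c c' \<or> homotopic_loops S (reversepath c) c'}"

definition disjointly_realised_by ::
    "'a::topological_space set \<Rightarrow> (real \<Rightarrow> 'a) set set \<Rightarrow> ((real \<Rightarrow> 'a) set \<Rightarrow> real \<Rightarrow> 'a) \<Rightarrow> bool" where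
  "disjointly_realised_by S L r \<longleftrightarrow>
     (\<forall>C\<in>L. simple_closed_curve S (r C) \<and> nontrivial_curve S (r C) \<and> C = curve_class S (r C)) \<and>
     (\<forall>C\<in>L. \<forall>D\<in>L. C \<noteq> D \<longrightarrow> path_image (r C) \<inter> path_image (r D) = {})"

definition curve_system :: "'a::topological_space set \<Rightarrow> (real \<Rightarrow> 'a) set set \<Rightarrow> bool" where
  "curve_system S L \<longleftrightarrow>
     (\<exists>r. disjointly_realised_by S L r) \<and>
     (\<forall>L'. L \<subseteq> L' \<longrightarrow> (\<exists>r. disjointly_realised_by S L' r) \<longrightarrow> L' = L)"

section \<open>Pants decompositions and generators of the surface group\<close>

text \<open>Labels of the three boundary curves of a pair of pants.\<close>

datatype bdry = Alpha | Beta | Delta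

text \<open>Labels of the generators of the surface group: boundary generators of the pairs of pants
  and the elements \<open>d\<^sub>j\<close>.\<close>

datatype gen = Bdry nat bdry | Stable nat

record 'a marking =
  basept :: 'a
  curve :: "nat \<Rightarrow> real \<Rightarrow> 'a"
  pants :: "nat \<Rightarrow> 'a set"
  pants_pt :: "nat \<Rightarrow> 'a"
  pants_path :: "nat \<Rightarrow> real \<Rightarrow> 'a"
  bdry_loop :: "nat \<Rightarrow> bdry \<Rightarrow> real \<Rightarrow> 'a"
  side :: "nat \<Rightarrow> nat \<times> bdry"
  side' :: "nat \<Rightarrow> nat \<times> bdry"
  tree :: "nat set"
  stable :: "nat \<Rightarrow> (real \<Rightarrow> 'a) set"

text \<open>In a marking \<open>M\<close>, the pair of pants \<open>pants M k\<close> has base point \<open>pants_pt M k\<close>, and its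
  fundamental group is carried to that of the surface (based at \<open>basept M\<close>) along the path
  \<open>pants_path M k\<close>.  If \<open>side M j = (k, e)\<close> and \<open>side' M j = (k', e')\<close> then \<open>a\<^sub>j\<close> is the generator
  of the \<open>k\<close>-th pair of pants labelled \<open>e\<close>, and \<open>a\<^sub>j'\<close> is the generator of the \<open>k'\<close>-th one
  labelled \<open>e'\<close>.\<close>

abbreviation surface_group :: "'a::topological_space set \<Rightarrow> 'a marking \<Rightarrow> (real \<Rightarrow> 'a) set monoid" where
  "surface_group S M \<equiv> pi1 S (basept M)"

definition transported ::
    "'a::topological_space set \<Rightarrow> 'a marking \<Rightarrow> nat \<Rightarrow> (real \<Rightarrow> 'a) \<Rightarrow> (real \<Rightarrow> 'a) set" where
  "transported S M k l = path_class S (pants_path M k +++ l +++ reversepath (pants_path M k))"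

definition bdry_gen :: "'a::topological_space set \<Rightarrow> 'a marking \<Rightarrow> nat \<Rightarrow> bdry \<Rightarrow> (real \<Rightarrow> 'a) set" where
  "bdry_gen S M k e = transported S M k (bdry_loop M k e)"

definition curve_gen :: "'a::topological_space set \<Rightarrow> 'a marking \<Rightarrow> nat \<Rightarrow> (real \<Rightarrow> 'a) set" where
  "curve_gen S M j = (case side M j of (k, e) \<Rightarrow> bdry_gen S M k e)"

text \<open>The image of the fundamental group of the \<open>k\<close>-th pair of pants.\<close>

definition pants_subgroup :: "'a::topological_space set \<Rightarrow> 'a marking \<Rightarrow> nat \<Rightarrow> (real \<Rightarrow> 'a) set set" where
  "pants_subgroup S M k = transported S M k ` loops_at (pants M k) (pants_pt M k)"

text \<open>The loop \<open>l\<close> in the open subset \<open>Y\<close> of \<open>S\<close> can be pushed onto its frontier curve \<open>c\<close>,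
  staying inside \<open>Y\<close> until the last moment.  (A homotopy in the closure of \<open>Y\<close> would not do: the
  closure may contain both sides of \<open>c\<close>.)\<close>

definition corresponds_to_boundary ::
    "'a::topological_space set \<Rightarrow> 'a set \<Rightarrow> (real \<Rightarrow> 'a) \<Rightarrow> (real \<Rightarrow> 'a) \<Rightarrow> bool" where
  "corresponds_to_boundary S Y l c \<longleftrightarrow>
     (\<exists>H :: real \<times> real \<Rightarrow> 'a. continuous_on ({0..1} \<times> {0..1}) H \<and>
          H ` ({0..1} \<times> {0..1}) \<subseteq> S \<and> H ` ({0..<1} \<times> {0..1}) \<subseteq> Y \<and>
          (\<forall>t\<in>{0..1}. H (0, t) = l t \<and> H (1, t) = c t) \<and>
          (\<forall>s\<in>{0..1}. H (s, 0) = H (s, 1)))"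

text \<open>The gluing graph has the pairs of pants as vertices; its edges are the curves, with end points
  given by the two sides.  Loops and multiple edges occur.\<close>

definition adjacent_via :: "'a marking \<Rightarrow> nat set \<Rightarrow> nat \<Rightarrow> nat \<Rightarrow> bool" where
  "adjacent_via M T k k' \<longleftrightarrow>
     (\<exists>j\<in>T. {k, k'} = {fst (side M j), fst (side' M j)})"

definition joined_via :: "'a marking \<Rightarrow> nat set \<Rightarrow> nat \<Rightarrow> nat \<Rightarrow> bool" where
  "joined_via M T = (adjacent_via M T)\<^sup>*\<^sup>*"

text \<open>Acyclicity: no edge lies on a cycle, i.e.\ removing any edge separates its end points.\<close>

definition spanning_tree :: "nat \<Rightarrow> 'a marking \<Rightarrow> nat set \<Rightarrow> bool" where
  "spanning_tree g M T \<longleftrightarrow>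
     T \<subseteq> {1..3 * g - 3} \<and>
     (\<forall>k\<in>{1..2 * g - 2}. \<forall>k'\<in>{1..2 * g - 2}. joined_via M T k k') \<and>
     (\<forall>j\<in>T. \<not> joined_via M (T - {j}) (fst (side M j)) (fst (side' M j)))"

definition surface_gens :: "nat \<Rightarrow> gen set" where
  "surface_gens g = {Bdry k e | k e. k \<in> {1..2 * g - 2}} \<union> {Stable j | j. j \<in> {1..3 * g - 3}}"

definition surface_gen_val :: "'a::topological_space set \<Rightarrow> 'a marking \<Rightarrow> gen \<Rightarrow> (real \<Rightarrow> 'a) set" where
  "surface_gen_val S M x = (case x of Bdry k e \<Rightarrow> bdry_gen S M k e | Stable j \<Rightarrow> stable M j)"

text \<open>The relators are \<open>\<delta>\<^sub>k \<beta>\<^sub>k \<alpha>\<^sub>k\<close>, then \<open>a\<^sub>j' d\<^sub>j a\<^sub>j d\<^sub>j\<^sup>-\<^sup>1\<close> (which says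
  \<open>a\<^sub>j' = d\<^sub>j a\<^sub>j\<^sup>-\<^sup>1 d\<^sub>j\<^sup>-\<^sup>1\<close>), and \<open>d\<^sub>j\<close> for \<open>j\<close> in the tree.\<close>

definition surface_relators :: "nat \<Rightarrow> 'a marking \<Rightarrow> (gen \<times> bool) list set" where
  "surface_relators g M =
     {[(Bdry k Delta, True), (Bdry k Beta, True), (Bdry k Alpha, True)] | k. k \<in> {1..2 * g - 2}} \<union>
     {[(case_prod Bdry (side' M j), True), (Stable j, True),
       (case_prod Bdry (side M j), True), (Stable j, False)] | j. j \<in> {1..3 * g - 3}} \<union>
     {[(Stable j, True)] | j. j \<in> tree M}"

definition pants_decomposition ::
    "nat \<Rightarrow> 'a::t2_space set \<Rightarrow> (real \<Rightarrow> 'a) set set \<Rightarrow> 'a marking \<Rightarrow> bool" where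
  "pants_decomposition g S L M \<longleftrightarrow>
     bij_betw (\<lambda>j. curve_class S (curve M j)) {1..3 * g - 3} L \<and>
     (\<forall>j\<in>{1..3 * g - 3}. simple_closed_curve S (curve M j)) \<and>
     (\<forall>i\<in>{1..3 * g - 3}. \<forall>j\<in>{1..3 * g - 3}.
        i \<noteq> j \<longrightarrow> path_image (curve M i) \<inter> path_image (curve M j) = {}) \<and>
     bij_betw (pants M) {1..2 * g - 2} (components (S - (\<Union>j\<in>{1..3 * g - 3}. path_image (curve M j))))"

definition boundary_generators :: "nat \<Rightarrow> 'a::t2_space set \<Rightarrow> 'a marking \<Rightarrow> bool" where
  "boundary_generators g S M \<longleftrightarrow>
     (\<forall>k\<in>{1..2 * g - 2}.
        pants_pt M k \<in> pants M k \<and>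
        (\<forall>e. bdry_loop M k e \<in> loops_at (pants M k) (pants_pt M k)) \<and>
        presented_by (pi1 (pants M k) (pants_pt M k)) UNIV
          (\<lambda>e. path_class (pants M k) (bdry_loop M k e))
          {[(Delta, True), (Beta, True), (Alpha, True)]}) \<and>
     bij_betw (\<lambda>(j, b). if b then side M j else side' M j)
       ({1..3 * g - 3} \<times> UNIV) ({1..2 * g - 2} \<times> UNIV) \<and>
     (\<forall>j\<in>{1..3 * g - 3}.
        (case side M j of (k, e) \<Rightarrow>
           corresponds_to_boundary S (pants M k) (bdry_loop M k e) (curve M j)) \<and>
        (case side' M j of (k, e) \<Rightarrow>
           corresponds_to_boundary S (pants M k) (bdry_loop M k e) (reversepath (curve M j))))"

text \<open>The presentation of the surface group is part of what a marking has to provide; it is the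
  description of the fundamental group of the glued pairs of pants (van Kampen's theorem).\<close>

definition surface_generators :: "nat \<Rightarrow> 'a::t2_space set \<Rightarrow> 'a marking \<Rightarrow> bool" where
  "surface_generators g S M \<longleftrightarrow>
     basept M \<in> S \<and>
     (\<forall>k\<in>{1..2 * g - 2}.
        path (pants_path M k) \<and> path_image (pants_path M k) \<subseteq> S \<and>
        pathstart (pants_path M k) = basept M \<and> pathfinish (pants_path M k) = pants_pt M k) \<and>
     spanning_tree g M (tree M) \<and>
     presented_by (surface_group S M) (surface_gens g) (surface_gen_val S M) (surface_relators g M)"

definition marked_pants_decomposition ::
    "nat \<Rightarrow> 'a::t2_space set \<Rightarrow> (real \<Rightarrow> 'a) set set \<Rightarrow> 'a marking \<Rightarrow> bool" where
  "marked_pants_decomposition g S L M \<longleftrightarrow>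
     pants_decomposition g S L M \<and> boundary_generators g S M \<and> surface_generators g S M"

section \<open>Matrix groups\<close>

definition SL3C :: "(complex^3^3) monoid" where
  "SL3C = \<lparr>carrier = {A. det A = 1}, monoid.mult = (**), one = mat 1\<rparr>"

definition real_entries :: "complex^3^3 \<Rightarrow> bool" where
  "real_entries A \<longleftrightarrow> (\<forall>i j. A $ i $ j \<in> \<real>)"

definition SL3R :: "(complex^3^3) set" where
  "SL3R = {A. det A = 1 \<and> real_entries A}"

definition form_J :: "complex^3^3" where
  "form_J = vector [vector [0, 0, 1], vector [0, 1, 0], vector [1, 0, 0]]"

definition SO_J :: "(complex^3^3) set" where
  "SO_J = {A. real_entries A \<and> transpose A ** form_J ** A = form_J \<and> det A = 1}"

definition SO21_0 :: "(complex^3^3) set" where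
  "SO21_0 = connected_component_set SO_J (mat 1)"

definition eigenvalue :: "complex^3^3 \<Rightarrow> complex \<Rightarrow> bool" where
  "eigenvalue A c \<longleftrightarrow> (\<exists>v. v \<noteq> 0 \<and> A *v v = c *s v)"

definition loxodromic :: "complex^3^3 \<Rightarrow> bool" where
  "loxodromic A \<longleftrightarrow> (\<exists>c. eigenvalue A c \<and> cmod c \<noteq> 1)"

text \<open>The eigenvalues are meant with multiplicity, so there must be three of them.\<close>

definition strongly_loxodromic :: "complex^3^3 \<Rightarrow> bool" where
  "strongly_loxodromic A \<longleftrightarrow>
     (\<exists>a b c. eigenvalue A a \<and> eigenvalue A b \<and> eigenvalue A c \<and>
        cmod a > cmod b \<and> cmod b > cmod c)"

section \<open>Representations and quasi-Fuchsian space\<close>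

type_synonym 'a rep = "(real \<Rightarrow> 'a) set \<Rightarrow> complex^3^3"

definition irreducible_on :: "(real \<Rightarrow> 'a) set set \<Rightarrow> 'a rep \<Rightarrow> bool" where
  "irreducible_on D \<rho> \<longleftrightarrow>
     (\<forall>W. vec.subspace W \<and> (\<forall>x\<in>D. \<forall>w\<in>W. \<rho> x *v w \<in> W) \<longrightarrow> W = {0} \<or> W = UNIV)"

definition reps_into :: "'a::topological_space set \<Rightarrow> 'a marking \<Rightarrow> (complex^3^3) set \<Rightarrow> 'a rep set" where
  "reps_into S M G =
     {\<rho>. \<rho> \<in> hom (surface_group S M) SL3C \<and> \<rho> ` carrier (surface_group S M) \<subseteq> G}"

definition discrete_faithful :: "'a::topological_space set \<Rightarrow> 'a marking \<Rightarrow> 'a rep \<Rightarrow> bool" where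
  "discrete_faithful S M \<rho> \<longleftrightarrow>
     discrete (\<rho> ` carrier (surface_group S M)) \<and> inj_on \<rho> (carrier (surface_group S M))"

definition totally ::
    "(complex^3^3 \<Rightarrow> bool) \<Rightarrow> 'a::topological_space set \<Rightarrow> 'a marking \<Rightarrow> 'a rep \<Rightarrow> bool" where
  "totally P S M \<rho> \<longleftrightarrow>
     (\<forall>x\<in>carrier (surface_group S M). x \<noteq> \<one>\<^bsub>surface_group S M\<^esub> \<longrightarrow> P (\<rho> x))"

definition Fuchsian :: "'a::topological_space set \<Rightarrow> 'a marking \<Rightarrow> 'a rep \<Rightarrow> bool" where
  "Fuchsian S M \<rho> \<longleftrightarrow>
     \<rho> \<in> reps_into S M SO21_0 \<and> irreducible_on (carrier (surface_group S M)) \<rho> \<and>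
     discrete_faithful S M \<rho> \<and> totally loxodromic S M \<rho>"

definition dfsl_reps ::
    "'a::topological_space set \<Rightarrow> 'a marking \<Rightarrow> (complex^3^3) set \<Rightarrow> 'a rep set" where
  "dfsl_reps S M G =
     {\<rho> \<in> reps_into S M G. discrete_faithful S M \<rho> \<and> totally strongly_loxodromic S M \<rho>}"

definition conjugate_reps :: "'a::topological_space set \<Rightarrow> 'a marking \<Rightarrow> 'a rep \<Rightarrow> 'a rep \<Rightarrow> bool" where
  "conjugate_reps S M \<rho> \<rho>' \<longleftrightarrow>
     (\<exists>h\<in>carrier SL3C. \<forall>x\<in>carrier (surface_group S M). \<rho>' x = h ** \<rho> x ** matrix_inv h)"

definition conj_class :: "'a::topological_space set \<Rightarrow> 'a marking \<Rightarrow> 'a rep \<Rightarrow> 'a rep set" where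
  "conj_class S M \<rho> = {\<rho>'. conjugate_reps S M \<rho> \<rho>'}"

text \<open>The space denoted by a calligraphic Y.\<close>

definition Y_space :: "nat \<Rightarrow> 'a::topological_space set \<Rightarrow> 'a marking \<Rightarrow> 'a rep set set" where
  "Y_space g S M =
     {conj_class S M \<rho> | \<rho>. \<rho> \<in> hom (surface_group S M) SL3C \<and>
        (\<forall>j\<in>{1..3 * g - 3}. strongly_loxodromic (\<rho> (curve_gen S M j))) \<and>
        (\<forall>k\<in>{1..2 * g - 2}. irreducible_on (pants_subgroup S M k) \<rho>)}"

text \<open>Paths of representations are continuous for the topology of pointwise convergence.\<close>

definition connected_to_Fuchsian ::
    "'a::topological_space set \<Rightarrow> 'a marking \<Rightarrow> (complex^3^3) set \<Rightarrow> 'a rep \<Rightarrow> bool" where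
  "connected_to_Fuchsian S M G \<rho> \<longleftrightarrow>
     (\<exists>P :: real \<Rightarrow> 'a rep.
        (\<forall>t\<in>{0..1}. P t \<in> dfsl_reps S M G) \<and>
        (\<forall>x\<in>carrier (surface_group S M). continuous_on {0..1} (\<lambda>t. P t x)) \<and>
        Fuchsian S M (P 0) \<and> P 1 = \<rho>)"

definition Q_space ::
    "nat \<Rightarrow> 'a::topological_space set \<Rightarrow> 'a marking \<Rightarrow> (complex^3^3) set \<Rightarrow> 'a rep set set" where
  "Q_space g S M G =
     {conj_class S M \<rho> | \<rho>. \<rho> \<in> dfsl_reps S M G \<and> connected_to_Fuchsian S M G \<rho>} \<inter> Y_space g S M"

text \<open>Representations into \<open>SL(3,\<real>)\<close> whose conjugacy class lies in quasi-Fuchsian space.\<close>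

definition QF_real :: "nat \<Rightarrow> 'a::topological_space set \<Rightarrow> 'a marking \<Rightarrow> 'a rep set" where
  "QF_real g S M = {\<rho> \<in> reps_into S M SL3R. conj_class S M \<rho> \<in> Q_space g S M SL3R}"

section \<open>Traces, shape invariants and commutator equations\<close>

definition commutator :: "complex^3^3 \<Rightarrow> complex^3^3 \<Rightarrow> complex^3^3" where
  "commutator A B = A ** B ** matrix_inv A ** matrix_inv B"

definition shape :: "complex^3^3 \<Rightarrow> complex^3^3 \<Rightarrow> complex" where
  "shape A B = trace (matrix_inv A ** B) - trace (matrix_inv A) * trace B"

definition commutator_equation :: "complex^3^3 \<Rightarrow> complex^3^3 \<Rightarrow> complex poly" where
  "commutator_equation A B =
     [:trace (commutator A B) * trace (commutator B A),
       - (trace (commutator A B) + trace (commutator B A)), 1:]"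

lemma commutator_equation_root: "poly (commutator_equation A B) (trace (commutator A B)) = 0"
  by (simp add: commutator_equation_def algebra_simps)

text \<open>The data are functions on the index sets, extended by \<open>undefined\<close>.\<close>

definition trace_data ::
    "nat \<Rightarrow> 'a::topological_space set \<Rightarrow> 'a marking \<Rightarrow> 'a rep \<Rightarrow> nat \<Rightarrow> complex \<times> complex" where
  "trace_data g S M \<rho> =
     (\<lambda>j\<in>{1..3 * g - 3}. (trace (\<rho> (curve_gen S M j)), trace (matrix_inv (\<rho> (curve_gen S M j)))))"

definition shape_data ::
    "nat \<Rightarrow> 'a::topological_space set \<Rightarrow> 'a marking \<Rightarrow> 'a rep \<Rightarrow> nat \<Rightarrow> complex \<times> complex" where
  "shape_data g S M \<rho> =
     (\<lambda>k\<in>{1..2 * g - 2}.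
        (shape (\<rho> (bdry_gen S M k Alpha)) (\<rho> (bdry_gen S M k Beta)),
         shape (\<rho> (bdry_gen S M k Beta)) (\<rho> (bdry_gen S M k Alpha))))"

text \<open>The choice of a root of the commutator equation, i.e.\ which of its roots is \<open>tr[A,B]\<close>.\<close>

definition root_data ::
    "nat \<Rightarrow> 'a::topological_space set \<Rightarrow> 'a marking \<Rightarrow> 'a rep \<Rightarrow> nat \<Rightarrow> complex" where
  "root_data g S M \<rho> =
     (\<lambda>k\<in>{1..2 * g - 2}.
        trace (commutator (\<rho> (bdry_gen S M k Alpha)) (\<rho> (bdry_gen S M k Beta))))"

section \<open>Twist and bulge\<close>

type_synonym pants_data = "(nat \<Rightarrow> complex \<times> complex) \<times> (nat \<Rightarrow> complex \<times> complex) \<times> (nat \<Rightarrow> complex)"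

definition pants_data :: "nat \<Rightarrow> 'a::topological_space set \<Rightarrow> 'a marking \<Rightarrow> 'a rep \<Rightarrow> pants_data" where
  "pants_data g S M \<rho> = (trace_data g S M \<rho>, shape_data g S M \<rho>, root_data g S M \<rho>)"

definition reference_choice ::
    "nat \<Rightarrow> 'a::topological_space set \<Rightarrow> 'a marking \<Rightarrow> (pants_data \<Rightarrow> 'a rep) \<Rightarrow> bool" where
  "reference_choice g S M ref \<longleftrightarrow>
     (\<forall>D \<in> pants_data g S M ` QF_real g S M.
        ref D \<in> QF_real g S M \<and> pants_data g S M (ref D) = D)"

text \<open>By irreducibility the conjugating matrix \<open>g\<^sub>k\<close> is unique when it exists.\<close>

definition pants_conjugator ::
    "'a::topological_space set \<Rightarrow> 'a marking \<Rightarrow> 'a rep \<Rightarrow> 'a rep \<Rightarrow> nat \<Rightarrow> complex^3^3" where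
  "pants_conjugator S M \<rho>0 \<rho> k =
     (SOME h. h \<in> SL3R \<and> (\<forall>x\<in>pants_subgroup S M k. \<rho> x = h ** \<rho>0 x ** matrix_inv h))"

definition gluing_matrix ::
    "'a::topological_space set \<Rightarrow> 'a marking \<Rightarrow> 'a rep \<Rightarrow> 'a rep \<Rightarrow> nat \<Rightarrow> complex^3^3" where
  "gluing_matrix S M \<rho>0 \<rho> j =
     (let h = pants_conjugator S M \<rho>0 \<rho> (fst (side M j));
          h' = pants_conjugator S M \<rho>0 \<rho> (fst (side' M j))
      in if j \<in> tree M then matrix_inv h ** h'
         else matrix_inv (\<rho>0 (stable M j)) ** (matrix_inv h' ** \<rho> (stable M j) ** h))"

text \<open>\<open>K\<close> has eigenvalues \<open>\<kappa>\<^sub>1, \<kappa>\<^sub>2, \<kappa>\<^sub>3\<close> on the eigenvectors of \<open>A\<close> for its eigenvalues of largest,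
  middle and smallest absolute value.\<close>

definition eigenvalues_along ::
    "complex^3^3 \<Rightarrow> complex^3^3 \<Rightarrow> complex \<Rightarrow> complex \<Rightarrow> complex \<Rightarrow> bool" where
  "eigenvalues_along A K \<kappa>1 \<kappa>2 \<kappa>3 \<longleftrightarrow>
     (\<exists>a1 a2 a3 v1 v2 v3.
        cmod a1 > cmod a2 \<and> cmod a2 > cmod a3 \<and> v1 \<noteq> 0 \<and> v2 \<noteq> 0 \<and> v3 \<noteq> 0 \<and>
        A *v v1 = a1 *s v1 \<and> A *v v2 = a2 *s v2 \<and> A *v v3 = a3 *s v3 \<and>
        K *v v1 = \<kappa>1 *s v1 \<and> K *v v2 = \<kappa>2 *s v2 \<and> K *v v3 = \<kappa>3 *s v3)"

text \<open>\<open>\<rho>\<close> has twist \<open>t\<close>, bend \<open>\<theta>\<close>, bulge \<open>s\<close> and turn \<open>\<phi>\<close> along the \<open>j\<close>-th curve, relative to \<open>\<rho>0\<close>.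
  The angles only matter modulo \<open>2\<pi>\<close> and \<open>\<pi>\<close> respectively, so this is a relation rather than a
  function.\<close>

definition has_twist_bend_bulge_turn ::
    "'a::topological_space set \<Rightarrow> 'a marking \<Rightarrow> 'a rep \<Rightarrow> 'a rep \<Rightarrow> nat \<Rightarrow>
     real \<Rightarrow> real \<Rightarrow> real \<Rightarrow> real \<Rightarrow> bool" where
  "has_twist_bend_bulge_turn S M \<rho>0 \<rho> j t \<theta> s \<phi> \<longleftrightarrow>
     (let u = Complex t \<theta>; v = Complex s \<phi> in
        eigenvalues_along (\<rho>0 (curve_gen S M j)) (gluing_matrix S M \<rho>0 \<rho> j)
          (exp (u - v)) (exp (2 * v)) (exp (- u - v)))"

text \<open>In \<open>SL(3,\<real>)\<close> quasi-Fuchsian space the bend and the turn are zero: \<open>\<kappa>\<^sub>1 = e\<^sup>t\<^sup>-\<^sup>s\<close>,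
  \<open>\<kappa>\<^sub>2 = e\<^sup>2\<^sup>s\<close>, \<open>\<kappa>\<^sub>3 = e\<^sup>-\<^sup>t\<^sup>-\<^sup>s\<close>.\<close>

definition has_twist_bulge ::
    "'a::topological_space set \<Rightarrow> 'a marking \<Rightarrow> 'a rep \<Rightarrow> 'a rep \<Rightarrow> nat \<Rightarrow> real \<Rightarrow> real \<Rightarrow> bool" where
  "has_twist_bulge S M \<rho>0 \<rho> j t s \<longleftrightarrow> has_twist_bend_bulge_turn S M \<rho>0 \<rho> j t 0 s 0"

end

theory Submission
  imports Defs
begin

text \<open>On each pair of pants the representation is determined up to conjugation: diagonalise
  \<open>A = \<rho>(\<alpha>\<^sub>k)\<close>, whose eigenvalues are distinct and given by its traces.  The remaining traces then
  determine the diagonal entries of \<open>B = \<rho>(\<beta>\<^sub>k)\<close> and its products of entries along 2-cycles and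
  3-cycles; the root of the commutator equation tells the two 3-cycles apart.  By irreducibility these
  products determine \<open>B\<close> up to conjugation by a diagonal matrix.  A conjugation between real
  representations can be chosen real.

  Comparing \<open>\<rho>\<close> and \<open>\<rho>'\<close> with the same reference representation gives conjugating matrices
  \<open>h\<^sub>k, h\<^sub>k'\<close> for each pair of pants.  Twist and bulge determine the gluing matrices.  Equality of the
  gluing matrices along the spanning tree means that \<open>h\<^sub>k' h\<^sub>k\<^sup>-\<^sup>1\<close> does not depend on \<open>k\<close>, and along the
  other curves that this matrix also conjugates \<open>\<rho>(d\<^sub>j)\<close> to \<open>\<rho>'(d\<^sub>j)\<close>.\<close>

section \<open>Pairs of matrices determined by traces\<close>

lemma matrix_inv_det:
  fixes A :: "'a::field^'n^'n"
  assumes "det A \<noteq> 0"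
  shows "A ** matrix_inv A = mat 1" "matrix_inv A ** A = mat 1"
proof -
  have "\<exists>A'. A ** A' = mat 1 \<and> A' ** A = mat 1"
    using assms invertible_det_nz unfolding invertible_def by blast
  from someI_ex[OF this] show "A ** matrix_inv A = mat 1" "matrix_inv A ** A = mat 1"
    unfolding matrix_inv_def by auto
qed

lemma matrix_inv_eqI:
  fixes A :: "'a::field^'n^'n"
  assumes "A ** B = mat 1"
  shows "matrix_inv A = B"
proof -
  have "det A * det B = 1"
    using assms by (metis det_I det_mul)
  then have "det A \<noteq> 0" by auto
  then show ?thesis
    by (metis assms matrix_inv_det(2) matrix_mul_assoc matrix_mul_lid matrix_mul_rid)
qed

lemma matrix_inv_mul:
  fixes A B :: "'a::field^'n^'n"
  assumes "det A \<noteq> 0" "det B \<noteq> 0"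
  shows "matrix_inv (A ** B) = matrix_inv B ** matrix_inv A"
proof (rule matrix_inv_eqI)
  have "A ** B ** (matrix_inv B ** matrix_inv A) = A ** (B ** matrix_inv B) ** matrix_inv A"
    by (simp only: matrix_mul_assoc)
  then show "A ** B ** (matrix_inv B ** matrix_inv A) = mat 1"
    by (simp add: matrix_inv_det assms)
qed

lemma matrix_inv_inv:
  fixes A :: "'a::field^'n^'n"
  assumes "det A \<noteq> 0"
  shows "matrix_inv (matrix_inv A) = A"
  by (rule matrix_inv_eqI) (simp add: matrix_inv_det assms)

lemma det_matrix_inv:
  fixes A :: "'a::field^'n^'n"
  assumes "det A \<noteq> 0"
  shows "det (matrix_inv A) = 1 / det A"
proof -
  have "det A * det (matrix_inv A) = 1"
    using assms by (metis det_I det_mul matrix_inv_det(1))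
  then show ?thesis using assms by (simp add: field_simps)
qed

lemma conj_eq_iff:
  fixes A B P :: "'a::field^'n^'n"
  assumes "det P \<noteq> 0"
  shows "B = P ** A ** matrix_inv P \<longleftrightarrow> B ** P = P ** A"
proof
  assume "B = P ** A ** matrix_inv P"
  then show "B ** P = P ** A"
    by (simp add: matrix_mul_assoc[symmetric] matrix_inv_det assms)
next
  assume "B ** P = P ** A"
  then have "P ** A ** matrix_inv P = B ** (P ** matrix_inv P)"
    by (simp add: matrix_mul_assoc)
  then show "B = P ** A ** matrix_inv P"
    by (simp add: matrix_inv_det assms)
qed

text \<open>The classical adjugate, entry by entry. For determinant one it is the inverse, so
  statements about inverses become polynomial identities in the entries.\<close>

definition adj3 :: "'a::comm_ring_1^3^3 \<Rightarrow> 'a^3^3" where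
  "adj3 B = vector [
     vector [B$2$2 * B$3$3 - B$2$3 * B$3$2, B$1$3 * B$3$2 - B$1$2 * B$3$3, B$1$2 * B$2$3 - B$1$3 * B$2$2],
     vector [B$2$3 * B$3$1 - B$2$1 * B$3$3, B$1$1 * B$3$3 - B$1$3 * B$3$1, B$1$3 * B$2$1 - B$1$1 * B$2$3],
     vector [B$2$1 * B$3$2 - B$2$2 * B$3$1, B$1$2 * B$3$1 - B$1$1 * B$3$2, B$1$1 * B$2$2 - B$1$2 * B$2$1]]"

lemma matrix_inv_adj3:
  fixes B :: "'a::field^3^3"
  assumes "det B = 1"
  shows "matrix_inv B = adj3 B"
proof (rule matrix_inv_eqI)
  have d: "det B = 1" by fact
  show "B ** adj3 B = mat 1"
    unfolding vec_eq_iff forall_3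
    using d by (simp add: matrix_matrix_mult_def sum_3 adj3_def mat_def det_3 algebra_simps)
qed

section \<open>Conjugation by diagonal matrices and products of entries along cycles\<close>

definition diag3 :: "'a::zero \<Rightarrow> 'a \<Rightarrow> 'a \<Rightarrow> 'a^3^3" where
  "diag3 a b c = vector [vector [a, 0, 0], vector [0, b, 0], vector [0, 0, c]]"

text \<open>The conclusions are the off-diagonal entries of \<open>c D = D b\<close> for a diagonal
  \<open>D\<close>. Since \<open>D\<close> matters only up to a scalar, put \<open>d1 = 1\<close>
  and read off \<open>d2\<close> and \<open>d3\<close> along the path 1-2-3 of nonzero entries. The
  2-cycle products settle the reverse entries, the 3-cycle product settles entry 31, and entry 13
  follows from its 2-cycle product or vanishes on both sides. Entries are separate variables so that
  the lemma applies to any renumbering of the indices.\<close>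

lemma path_scaling:
  fixes b12 b13 b21 b23 b31 b32 c12 c13 c21 c23 c31 c32 :: "'a::field"
  assumes nz: "b12 \<noteq> 0" "b23 \<noteq> 0" "c12 \<noteq> 0" "c23 \<noteq> 0"
    and p: "b12 * b21 = c12 * c21" "b13 * b31 = c13 * c31" "b23 * b32 = c23 * c32"
    and x: "b12 * b23 * b31 = c12 * c23 * c31"
    and o: "b31 \<noteq> 0 \<or> b13 = 0 \<and> c13 = 0"
  obtains d1 d2 d3 where "d1 \<noteq> 0" "d2 \<noteq> 0" "d3 \<noteq> 0"
    "c12 * d2 = d1 * b12" "c21 * d1 = d2 * b21" "c13 * d3 = d1 * b13" "c31 * d1 = d3 * b31"
    "c23 * d3 = d2 * b23" "c32 * d2 = d3 * b32"
proof
  define d2 where "d2 = b12 / c12"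
  define d3 where "d3 = d2 * b23 / c23"
  show "(1::'a) \<noteq> 0" "d2 \<noteq> 0" "d3 \<noteq> 0" using nz by (auto simp: d2_def d3_def)
  show "c12 * d2 = 1 * b12" "c23 * d3 = d2 * b23" using nz by (auto simp: d2_def d3_def)
  show "c21 * 1 = d2 * b21" using nz p(1) by (simp add: d2_def field_simps)
  show "c32 * d2 = d3 * b32" using nz p(3) by (simp add: d3_def field_simps)
  show c31: "c31 * 1 = d3 * b31" using nz x by (simp add: d3_def d2_def field_simps)
  show "c13 * d3 = 1 * b13"
  proof (cases "b31 = 0")
    case False
    have "b13 * b31 = c13 * (d3 * b31)" using c31 p(2) by simp
    with False show ?thesis by simp
  qed (use o in auto)
qed

text \<open>Strong connectivity of the digraph of nonzero entries, phrased by cuts: a set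
  \<open>I\<close> without an outgoing entry would span a coordinate subspace invariant under
  \<open>b\<close>. The diagonal never crosses a cut.\<close>

definition strongly_connected3 :: "'a::zero^3^3 \<Rightarrow> bool" where
  "strongly_connected3 b \<longleftrightarrow>
     (\<forall>I. I \<noteq> {} \<longrightarrow> I \<noteq> UNIV \<longrightarrow> (\<exists>i\<in>-I. \<exists>j\<in>I. b$i$j \<noteq> 0))"

text \<open>The six clauses are the cuts at the three singletons and the three pairs.\<close>

lemma strongly_connected3D:
  assumes "strongly_connected3 b"
  shows "b$2$1 \<noteq> 0 \<or> b$3$1 \<noteq> 0" "b$1$2 \<noteq> 0 \<or> b$3$2 \<noteq> 0" "b$1$3 \<noteq> 0 \<or> b$2$3 \<noteq> 0"
    "b$3$1 \<noteq> 0 \<or> b$3$2 \<noteq> 0" "b$2$1 \<noteq> 0 \<or> b$2$3 \<noteq> 0" "b$1$2 \<noteq> 0 \<or> b$1$3 \<noteq> 0"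
proof -
  have c: "-{1::3} = {2,3}" "-{2::3} = {1,3}" "-{3::3} = {1,2}"
    "-{1::3,2} = {3}" "-{1::3,3} = {2}" "-{2::3,3} = {1}"
    using exhaust_3 by auto
  have u: "{1::3} \<noteq> UNIV" "{2::3} \<noteq> UNIV" "{3::3} \<noteq> UNIV" "{1::3,2} \<noteq> UNIV" "{1::3,3} \<noteq> UNIV" "{2::3,3} \<noteq> UNIV"
    using c by fastforce+
  have *: "I \<noteq> {} \<Longrightarrow> I \<noteq> UNIV \<Longrightarrow> \<exists>i\<in>-I. \<exists>j\<in>I. b$i$j \<noteq> 0" for I
    using assms unfolding strongly_connected3_def by blast
  show "b$2$1 \<noteq> 0 \<or> b$3$1 \<noteq> 0" "b$1$2 \<noteq> 0 \<or> b$3$2 \<noteq> 0" "b$1$3 \<noteq> 0 \<or> b$2$3 \<noteq> 0"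
    "b$3$1 \<noteq> 0 \<or> b$3$2 \<noteq> 0" "b$2$1 \<noteq> 0 \<or> b$2$3 \<noteq> 0" "b$1$2 \<noteq> 0 \<or> b$1$3 \<noteq> 0"
    using *[OF _ u(1)] *[OF _ u(2)] *[OF _ u(3)] *[OF _ u(4)] *[OF _ u(5)] *[OF _ u(6)]
    unfolding c by auto
qed

text \<open>The digraph of the nonzero off-diagonal entries contains either a 3-cycle or two 2-cycles that
  share a vertex; in both cases a path of length two along nonzero entries fixes the scaling
  factors.\<close>

lemma cycle_products_determine:
  fixes b c :: "'a::field^3^3"
  assumes sb: "strongly_connected3 b" and sc: "strongly_connected3 c"
    and d: "\<forall>i. b$i$i = c$i$i"
    and p: "b$1$2 * b$2$1 = c$1$2 * c$2$1" "b$1$3 * b$3$1 = c$1$3 * c$3$1" "b$2$3 * b$3$2 = c$2$3 * c$3$2"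
    and x: "b$1$2 * b$2$3 * b$3$1 = c$1$2 * c$2$3 * c$3$1"
    and y: "b$1$3 * b$3$2 * b$2$1 = c$1$3 * c$3$2 * c$2$1"
  obtains d1 d2 d3 where "d1 \<noteq> 0" "d2 \<noteq> 0" "d3 \<noteq> 0"
    "c ** diag3 d1 d2 d3 = diag3 d1 d2 d3 ** b"
proof -
  note B = strongly_connected3D[OF sb] and C = strongly_connected3D[OF sc]
  have "\<exists>d1 d2 d3. d1 \<noteq> 0 \<and> d2 \<noteq> 0 \<and> d3 \<noteq> 0 \<and>
    c$1$2 * d2 = d1 * b$1$2 \<and> c$2$1 * d1 = d2 * b$2$1 \<and> c$1$3 * d3 = d1 * b$1$3 \<and>
    c$3$1 * d1 = d3 * b$3$1 \<and> c$2$3 * d3 = d2 * b$2$3 \<and> c$3$2 * d2 = d3 * b$3$2"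
  proof -
    consider "b$1$2 * b$2$3 * b$3$1 \<noteq> 0" | "b$1$3 * b$3$2 * b$2$1 \<noteq> 0"
      | "b$1$2 * b$2$3 * b$3$1 = 0" "b$1$3 * b$3$2 * b$2$1 = 0" by blast
    then show ?thesis
    proof cases
      case 1
      then have "c$1$2 * c$2$3 * c$3$1 \<noteq> 0" using x by simp
      with 1 have n: "b$1$2 \<noteq> 0" "b$2$3 \<noteq> 0" "c$1$2 \<noteq> 0" "c$2$3 \<noteq> 0" "b$3$1 \<noteq> 0" by auto
      obtain d1 d2 d3 where "d1 \<noteq> 0" "d2 \<noteq> 0" "d3 \<noteq> 0"
        "c$1$2 * d2 = d1 * b$1$2" "c$2$1 * d1 = d2 * b$2$1" "c$1$3 * d3 = d1 * b$1$3"
        "c$3$1 * d1 = d3 * b$3$1" "c$2$3 * d3 = d2 * b$2$3" "c$3$2 * d2 = d3 * b$3$2"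
        using path_scaling[OF n(1-4) p x disjI1[OF n(5)]] by metis
      then show ?thesis by blast
    next
      case 2
      then have "c$1$3 * c$3$2 * c$2$1 \<noteq> 0" using y by simp
      with 2 have n: "b$1$3 \<noteq> 0" "b$3$2 \<noteq> 0" "c$1$3 \<noteq> 0" "c$3$2 \<noteq> 0" "b$2$1 \<noteq> 0" by auto
      have p3: "b$3$2 * b$2$3 = c$3$2 * c$2$3" using p(3) by (simp add: mult.commute)
      obtain d1 d2 d3 where "d1 \<noteq> 0" "d2 \<noteq> 0" "d3 \<noteq> 0"
        "c$1$2 * d2 = d1 * b$1$2" "c$2$1 * d1 = d2 * b$2$1" "c$1$3 * d3 = d1 * b$1$3"
        "c$3$1 * d1 = d3 * b$3$1" "c$2$3 * d3 = d2 * b$2$3" "c$3$2 * d2 = d3 * b$3$2"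
        using path_scaling[OF n(1-4) p(2,1) p3 y disjI1[OF n(5)]] by metis
      then show ?thesis by blast
    next
      case 3
      then have 3: "b$1$2 = 0 \<or> b$2$3 = 0 \<or> b$3$1 = 0" "b$1$3 = 0 \<or> b$3$2 = 0 \<or> b$2$1 = 0"
        "c$1$2 = 0 \<or> c$2$3 = 0 \<or> c$3$1 = 0" "c$1$3 = 0 \<or> c$3$2 = 0 \<or> c$2$1 = 0"
        using x y by auto
      have z: "(b$1$2 = 0 \<or> b$2$1 = 0) = (c$1$2 = 0 \<or> c$2$1 = 0)"
        "(b$1$3 = 0 \<or> b$3$1 = 0) = (c$1$3 = 0 \<or> c$3$1 = 0)"
        "(b$2$3 = 0 \<or> b$3$2 = 0) = (c$2$3 = 0 \<or> c$3$2 = 0)"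
        using p by (metis mult_eq_0_iff)+
      \<comment> \<open>By connectivity two 2-cycles meet at a vertex, which is 2, 3 or 1 in these
        cases. As there are no 3-cycles, the entry between the two ends of the path must vanish.
        Equality of the 2-cycle products transfers the pattern from \<open>b\<close> to
        \<open>c\<close>.\<close>
      consider
        "b$1$2 \<noteq> 0" "b$2$3 \<noteq> 0" "c$1$2 \<noteq> 0" "c$2$3 \<noteq> 0" "b$1$3 = 0 \<and> c$1$3 = 0"
        | "b$1$3 \<noteq> 0" "b$3$2 \<noteq> 0" "c$1$3 \<noteq> 0" "c$3$2 \<noteq> 0" "b$1$2 = 0 \<and> c$1$2 = 0"
        | "b$2$1 \<noteq> 0" "b$1$3 \<noteq> 0" "c$2$1 \<noteq> 0" "c$1$3 \<noteq> 0" "b$2$3 = 0 \<and> c$2$3 = 0"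
        using 3 z B C by metis
      then show ?thesis
      proof cases
        case 1
        obtain d1 d2 d3 where "d1 \<noteq> 0" "d2 \<noteq> 0" "d3 \<noteq> 0"
          "c$1$2 * d2 = d1 * b$1$2" "c$2$1 * d1 = d2 * b$2$1" "c$1$3 * d3 = d1 * b$1$3"
          "c$3$1 * d1 = d3 * b$3$1" "c$2$3 * d3 = d2 * b$2$3" "c$3$2 * d2 = d3 * b$3$2"
          using path_scaling[OF 1(1-4) p x disjI2[OF 1(5)]] by metis
        then show ?thesis by blast
      next
        case 2
        have p3: "b$3$2 * b$2$3 = c$3$2 * c$2$3" using p(3) by (simp add: mult.commute)
        obtain d1 d2 d3 where "d1 \<noteq> 0" "d2 \<noteq> 0" "d3 \<noteq> 0"
          "c$1$2 * d2 = d1 * b$1$2" "c$2$1 * d1 = d2 * b$2$1" "c$1$3 * d3 = d1 * b$1$3"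
          "c$3$1 * d1 = d3 * b$3$1" "c$2$3 * d3 = d2 * b$2$3" "c$3$2 * d2 = d3 * b$3$2"
          using path_scaling[OF 2(1-4) p(2,1) p3 y disjI2[OF 2(5)]] by metis
        then show ?thesis by blast
      next
        case 3
        have p1: "b$2$1 * b$1$2 = c$2$1 * c$1$2" using p(1) by (simp add: mult.commute)
        have y': "b$2$1 * b$1$3 * b$3$2 = c$2$1 * c$1$3 * c$3$2" using y by (simp add: ac_simps)
        obtain d1 d2 d3 where "d1 \<noteq> 0" "d2 \<noteq> 0" "d3 \<noteq> 0"
          "c$1$2 * d2 = d1 * b$1$2" "c$2$1 * d1 = d2 * b$2$1" "c$1$3 * d3 = d1 * b$1$3"
          "c$3$1 * d1 = d3 * b$3$1" "c$2$3 * d3 = d2 * b$2$3" "c$3$2 * d2 = d3 * b$3$2"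
          using path_scaling[OF 3(1-4) p1 p(3,2) y' disjI2[OF 3(5)]] by metis
        then show ?thesis by blast
      qed
    qed
  qed
  then obtain d1 d2 d3 where D: "d1 \<noteq> 0" "d2 \<noteq> 0" "d3 \<noteq> 0"
        "c$1$2 * d2 = d1 * b$1$2" "c$2$1 * d1 = d2 * b$2$1" "c$1$3 * d3 = d1 * b$1$3"
        "c$3$1 * d1 = d3 * b$3$1" "c$2$3 * d3 = d2 * b$2$3" "c$3$2 * d2 = d3 * b$3$2"
    by blast
  have "c ** diag3 d1 d2 d3 = diag3 d1 d2 d3 ** b"
    unfolding vec_eq_iff forall_3
    using D d by (simp add: matrix_matrix_mult_def sum_3 diag3_def)
  with D that show thesis by blast
qed

section \<open>Cycle products recovered from traces\<close>

text \<open>The three rows of weights are the diagonals of the identity, of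
  \<open>A = diag3 a1 a2 a3\<close> and of its adjugate, which avoids division. For each unknown an
  explicit combination of the rows eliminates the other two and leaves a product of differences of
  the \<open>a\<close>'s as coefficient.\<close>

lemma vandermonde3:
  fixes a1 a2 a3 :: "'a::field"
  assumes "a1 \<noteq> a2" "a1 \<noteq> a3" "a2 \<noteq> a3"
    and "x1 + x2 + x3 = y1 + y2 + y3"
    and "a1 * x1 + a2 * x2 + a3 * x3 = a1 * y1 + a2 * y2 + a3 * y3"
    and "a2 * a3 * x1 + a1 * a3 * x2 + a1 * a2 * x3 = a2 * a3 * y1 + a1 * a3 * y2 + a1 * a2 * y3"
  shows "x1 = y1" "x2 = y2" "x3 = y3"
proof -
  define z1 z2 z3 where z: "z1 = x1 - y1" "z2 = x2 - y2" "z3 = x3 - y3"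
  have 1: "z1 + z2 + z3 = 0" "a1 * z1 + a2 * z2 + a3 * z3 = 0"
    "a2 * a3 * z1 + a1 * a3 * z2 + a1 * a2 * z3 = 0"
    using assms(4-6) unfolding z by (simp_all add: algebra_simps)
  have "(a1 - a2) * (a1 - a3) * z1 = (a2 * a3 * z1 + a1 * a3 * z2 + a1 * a2 * z3)
        + a1 * (a1 * z1 + a2 * z2 + a3 * z3) - a1 * (a2 + a3) * (z1 + z2 + z3)"
    "(a2 - a1) * (a2 - a3) * z2 = (a2 * a3 * z1 + a1 * a3 * z2 + a1 * a2 * z3)
        + a2 * (a1 * z1 + a2 * z2 + a3 * z3) - a2 * (a1 + a3) * (z1 + z2 + z3)"
    "(a3 - a1) * (a3 - a2) * z3 = (a2 * a3 * z1 + a1 * a3 * z2 + a1 * a2 * z3)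
        + a3 * (a1 * z1 + a2 * z2 + a3 * z3) - a3 * (a1 + a2) * (z1 + z2 + z3)"
    by (simp_all add: algebra_simps)
  then have "(a1 - a2) * (a1 - a3) * z1 = 0" "(a2 - a1) * (a2 - a3) * z2 = 0" "(a3 - a1) * (a3 - a2) * z3 = 0"
    unfolding 1 by simp_all
  then have "z1 = 0" "z2 = 0" "z3 = 0" using assms(1-3) by auto
  then show "x1 = y1" "x2 = y2" "x3 = y3" by (auto simp: z)
qed

text \<open>The traces of \<open>A\<^sup>e b\<close> and \<open>A\<^sup>e b\<^sup>-\<^sup>1\<close> for \<open>e = 0, 1, -1\<close> yield the diagonals of \<open>b\<close> and
  \<open>b\<^sup>-\<^sup>1\<close> by a Vandermonde argument; the second one gives the 2-cycles.  The determinant then gives the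
  sum of the two 3-cycles, and the commutator trace separates them.\<close>

lemma cycle_products_eq:
  fixes b c :: "complex^3^3"
  assumes a: "a1 \<noteq> a2" "a1 \<noteq> a3" "a2 \<noteq> a3"
    and db: "det b = 1" and dc: "det c = 1"
  defines "A \<equiv> diag3 a1 a2 a3"
  defines "A' \<equiv> diag3 (a2 * a3) (a1 * a3) (a1 * a2)"
  assumes t: "trace b = trace c" "trace (A ** b) = trace (A ** c)" "trace (A' ** b) = trace (A' ** c)"
    and t': "trace (adj3 b) = trace (adj3 c)" "trace (A ** adj3 b) = trace (A ** adj3 c)"
      "trace (A' ** adj3 b) = trace (A' ** adj3 c)"
    and k: "trace (A ** b ** A' ** adj3 b) = trace (A ** c ** A' ** adj3 c)"
  shows "\<forall>i. b$i$i = c$i$i"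
    "b$1$2 * b$2$1 = c$1$2 * c$2$1" "b$1$3 * b$3$1 = c$1$3 * c$3$1" "b$2$3 * b$3$2 = c$2$3 * c$3$2"
    "b$1$2 * b$2$3 * b$3$1 = c$1$2 * c$2$3 * c$3$1"
    "b$1$3 * b$3$2 * b$2$1 = c$1$3 * c$3$2 * c$2$1"
proof -
  have d: "b$1$1 = c$1$1" "b$2$2 = c$2$2" "b$3$3 = c$3$3"
    using vandermonde3[OF a, of "b$1$1" "b$2$2" "b$3$3" "c$1$1" "c$2$2" "c$3$3"] t
    unfolding A_def A'_def by (simp_all add: trace_def matrix_matrix_mult_def sum_3 diag3_def)
  then show "\<forall>i. b$i$i = c$i$i" by (simp add: forall_3)
  \<comment> \<open>The diagonal entries of the adjugate are principal 2 by 2 minors. With the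
    diagonal of \<open>b\<close> already known, they yield the 2-cycle products.\<close>
  have "adj3 b$1$1 = adj3 c$1$1" "adj3 b$2$2 = adj3 c$2$2" "adj3 b$3$3 = adj3 c$3$3"
    using vandermonde3[OF a, of "adj3 b$1$1" "adj3 b$2$2" "adj3 b$3$3" "adj3 c$1$1" "adj3 c$2$2" "adj3 c$3$3"] t'
    unfolding A_def A'_def by (simp_all add: trace_def matrix_matrix_mult_def sum_3 diag3_def)
  then show p: "b$1$2 * b$2$1 = c$1$2 * c$2$1" "b$1$3 * b$3$1 = c$1$3 * c$3$1" "b$2$3 * b$3$2 = c$2$3 * c$3$2"
    by (simp_all add: adj3_def d)
  define x y x' y' where xy: "x = b$1$2 * b$2$3 * b$3$1" "y = b$1$3 * b$3$2 * b$2$1"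
    "x' = c$1$2 * c$2$3 * c$3$1" "y' = c$1$3 * c$3$2 * c$2$1"
  \<comment> \<open>These are the weights of the two 3-cycles in the commutator trace.\<close>
  define u v where uv: "u = a1 * a1 * a3 + a2 * a2 * a1 + a3 * a3 * a2"
    "v = a2 * a2 * a3 + a3 * a3 * a1 + a1 * a1 * a2"
  have s: "x + y = x' + y'"
  proof -
    have "x + y = det b - b$1$1 * b$2$2 * b$3$3 + b$1$1 * (b$2$3 * b$3$2) + b$2$2 * (b$1$3 * b$3$1) + b$3$3 * (b$1$2 * b$2$1)"
      by (simp add: xy det_3 algebra_simps)
    also have "\<dots> = det c - c$1$1 * c$2$2 * c$3$3 + c$1$1 * (c$2$3 * c$3$2) + c$2$2 * (c$1$3 * c$3$1) + c$3$3 * (c$1$2 * c$2$1)"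
      by (simp only: d p db dc)
    also have "\<dots> = x' + y'" by (simp add: xy det_3 algebra_simps)
    finally show ?thesis .
  qed
  \<comment> \<open>Apart from the two 3-cycles, the trace involves only diagonal entries and
    2-cycle products, which agree for \<open>b\<close> and \<open>c\<close>.\<close>
  have tr: "trace (A ** m ** A' ** adj3 m) =
      (a1 * a2 * a3) * (m$1$1 * adj3 m$1$1 + m$2$2 * adj3 m$2$2 + m$3$3 * adj3 m$3$3)
      + u * (m$1$2 * m$2$3 * m$3$1) + v * (m$1$3 * m$3$2 * m$2$1)
      - (m$1$2 * m$2$1) * m$3$3 * (a1 * a1 * a3 + a2 * a2 * a3)
      - (m$1$3 * m$3$1) * m$2$2 * (a1 * a1 * a2 + a3 * a3 * a2)
      - (m$2$3 * m$3$2) * m$1$1 * (a2 * a2 * a1 + a3 * a3 * a1)" for m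
    unfolding A_def A'_def
    by (simp add: trace_def matrix_matrix_mult_def sum_3 diag3_def adj3_def uv algebra_simps)
  have ux: "u * x + v * y = u * x' + v * y'"
    using k unfolding tr xy by (simp add: adj3_def d p)
  \<comment> \<open>Two linear equations for the 3-cycles \<open>x\<close> and \<open>y\<close>,
    with rows \<open>(1, 1)\<close> and \<open>(u, v)\<close>. Their determinant is, up to sign, the
    Vandermonde product of the eigenvalues, so it does not vanish.\<close>
  have "(u - v) * (x - x') = 0"
  proof -
    have "(u - v) * (x - x') = (u * x + v * y) - (u * x' + v * y') - v * ((x + y) - (x' + y'))"
      by (simp add: algebra_simps)
    then show ?thesis unfolding ux s by simp
  qed
  moreover have "u - v = (a1 - a2) * (a1 - a3) * (a3 - a2)"
    by (simp add: uv algebra_simps)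
  ultimately have "x = x'" using a by auto
  with s have "y = y'" by simp
  show "b$1$2 * b$2$3 * b$3$1 = c$1$2 * c$2$3 * c$3$1"
    "b$1$3 * b$3$2 * b$2$1 = c$1$3 * c$3$2 * c$2$1"
    using \<open>x = x'\<close> \<open>y = y'\<close> by (auto simp: xy)
qed

section \<open>Diagonalisation and eigenlines\<close>

lemma diag3_mult_vec: "diag3 a1 a2 a3 *v y = vector [a1 * y$1, a2 * y$2, a3 * y$3]"
  unfolding vec_eq_iff forall_3 by (simp add: matrix_vector_mult_def sum_3 diag3_def)

text \<open>Independence of eigenvectors for distinct eigenvalues. By \<open>A P = P D\<close> the
  kernel of \<open>P\<close> is stable under \<open>D\<close>, so \<open>x\<close>,
  \<open>D x\<close> and \<open>D (D x)\<close> all lie in it. These three relations isolate each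
  column multiplied by the matching coordinate of \<open>x\<close>, and the columns are
  nonzero.\<close>

lemma eigenbasis_det_nonzero:
  fixes P A :: "'a::field^3^3"
  assumes AP: "A ** P = P ** diag3 a1 a2 a3"
    and col: "P *v axis 1 1 \<noteq> 0" "P *v axis 2 1 \<noteq> 0" "P *v axis 3 1 \<noteq> 0"
    and a: "a1 \<noteq> a2" "a1 \<noteq> a3" "a2 \<noteq> a3"
  shows "det P \<noteq> 0"
proof -
  have "x = 0" if x: "P *v x = 0" for x
  proof -
    define D where "D = diag3 a1 a2 a3"
    have step: "P *v (D *v y) = 0" if "P *v y = 0" for y
    proof -
      have "P *v (D *v y) = A *v (P *v y)"
        using AP by (simp add: matrix_vector_mul_assoc D_def)
      then show ?thesis using that by (simp add: matrix_vector_mult_0_right)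
    qed
    note z = x step[OF x] step[OF step[OF x]]
    have D: "D *v y = vector [a1 * y$1, a2 * y$2, a3 * y$3]" for y
      by (simp add: D_def diag3_mult_vec)
    have ax: "P$i$1 = (P *v axis 1 1)$i" "P$i$2 = (P *v axis 2 1)$i" "P$i$3 = (P *v axis 3 1)$i" for i
      by (simp_all add: matrix_vector_mult_def sum_3 axis_def)
    have e: "P$i$1 * x$1 + P$i$2 * x$2 + P$i$3 * x$3 = 0"
      "P$i$1 * (a1 * x$1) + P$i$2 * (a2 * x$2) + P$i$3 * (a3 * x$3) = 0"
      "P$i$1 * (a1 * (a1 * x$1)) + P$i$2 * (a2 * (a2 * x$2)) + P$i$3 * (a3 * (a3 * x$3)) = 0" for i
      using z[unfolded vec_eq_iff, THEN spec[of _ i]]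
      unfolding D by (simp_all add: matrix_vector_mult_def sum_3)
    \<comment> \<open>The first combination applies the polynomial \<open>(T - a2) (T - a3)\<close>
      to \<open>D\<close>, which kills the other two eigenvectors; the remaining two are
      analogous.\<close>
    have "(a1 - a2) * (a1 - a3) * (P$i$1 * x$1) =
        (P$i$1 * (a1 * (a1 * x$1)) + P$i$2 * (a2 * (a2 * x$2)) + P$i$3 * (a3 * (a3 * x$3)))
        - (a2 + a3) * (P$i$1 * (a1 * x$1) + P$i$2 * (a2 * x$2) + P$i$3 * (a3 * x$3))
        + a2 * a3 * (P$i$1 * x$1 + P$i$2 * x$2 + P$i$3 * x$3)"
      "(a2 - a1) * (a2 - a3) * (P$i$2 * x$2) =
        (P$i$1 * (a1 * (a1 * x$1)) + P$i$2 * (a2 * (a2 * x$2)) + P$i$3 * (a3 * (a3 * x$3)))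
        - (a1 + a3) * (P$i$1 * (a1 * x$1) + P$i$2 * (a2 * x$2) + P$i$3 * (a3 * x$3))
        + a1 * a3 * (P$i$1 * x$1 + P$i$2 * x$2 + P$i$3 * x$3)"
      "(a3 - a1) * (a3 - a2) * (P$i$3 * x$3) =
        (P$i$1 * (a1 * (a1 * x$1)) + P$i$2 * (a2 * (a2 * x$2)) + P$i$3 * (a3 * (a3 * x$3)))
        - (a1 + a2) * (P$i$1 * (a1 * x$1) + P$i$2 * (a2 * x$2) + P$i$3 * (a3 * x$3))
        + a1 * a2 * (P$i$1 * x$1 + P$i$2 * x$2 + P$i$3 * x$3)" for i
      by (simp_all add: algebra_simps)
    then have "P$i$1 * x$1 = 0" "P$i$2 * x$2 = 0" "P$i$3 * x$3 = 0" for i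
      unfolding e using a by simp_all
    then show "x = 0"
      using col unfolding vec_eq_iff forall_3 ax by auto
  qed
  then have "\<exists>B. B ** P = mat 1"
    by (subst matrix_left_invertible_ker) blast
  then show ?thesis
    using invertible_det_nz invertible_left_inverse by blast
qed

lemma diagonalize:
  fixes A :: "'a::field^3^3"
  assumes "v1 \<noteq> 0" "v2 \<noteq> 0" "v3 \<noteq> 0"
    and "A *v v1 = a1 *s v1" "A *v v2 = a2 *s v2" "A *v v3 = a3 *s v3"
    and a: "a1 \<noteq> a2" "a1 \<noteq> a3" "a2 \<noteq> a3"
  obtains P where "det P \<noteq> 0" "A ** P = P ** diag3 a1 a2 a3"
    "P *v axis 1 1 = v1" "P *v axis 2 1 = v2" "P *v axis 3 1 = v3"
proof -
  define P :: "'a^3^3" where "P = (\<chi> i. vector [v1$i, v2$i, v3$i])"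
  have col: "P *v axis 1 1 = v1" "P *v axis 2 1 = v2" "P *v axis 3 1 = v3"
    by (simp_all add: vec_eq_iff P_def matrix_vector_mult_def sum_3 axis_def)
  have e: "(\<Sum>k\<in>UNIV. A$i$k * v1$k) = a1 * v1$i" "(\<Sum>k\<in>UNIV. A$i$k * v2$k) = a2 * v2$i"
    "(\<Sum>k\<in>UNIV. A$i$k * v3$k) = a3 * v3$i" for i
    using assms(4-6)[THEN arg_cong[where f = "\<lambda>v. v$i"]] by (simp_all add: matrix_vector_mult_def)
  have "(A ** P)$i$j = (P ** diag3 a1 a2 a3)$i$j" for i j
    using exhaust_3[of j] e[of i]
    by (auto simp: matrix_matrix_mult_def P_def diag3_def sum_3 mult.commute)
  then have "A ** P = P ** diag3 a1 a2 a3"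
    by (simp add: vec_eq_iff)
  then show thesis
    using that eigenbasis_det_nonzero[of A P a1 a2 a3] col assms(1-3) a by simp
qed

lemma mult_axis:
  fixes M :: "'a::field^'n^'m"
  shows "(M *v axis j 1)$i = M$i$j"
  by (simp add: matrix_vector_mult_def axis_def if_distrib[of "(*) _"] sum.delta' cong: if_cong)

text \<open>In the coordinates \<open>y\<close> given by \<open>v = P y\<close>, the equation
  becomes \<open>D y = a y\<close>. Distinct diagonal entries leave \<open>y\<close> exactly one
  nonzero coordinate.\<close>

lemma eigenvector_of_diagonalized:
  fixes A P :: "'a::field^3^3"
  assumes P: "det P \<noteq> 0" "A ** P = P ** diag3 a1 a2 a3"
    and v: "v \<noteq> 0" "A *v v = a *s v"
    and d: "a1 \<noteq> a2" "a1 \<noteq> a3" "a2 \<noteq> a3"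
  shows "a = a1 \<and> (\<exists>c. c \<noteq> 0 \<and> v = c *s (P *v axis 1 1)) \<or>
         a = a2 \<and> (\<exists>c. c \<noteq> 0 \<and> v = c *s (P *v axis 2 1)) \<or>
         a = a3 \<and> (\<exists>c. c \<noteq> 0 \<and> v = c *s (P *v axis 3 1))"
proof -
  define y where "y = matrix_inv P *v v"
  have vy: "v = P *v y"
    by (simp add: y_def matrix_vector_mul_assoc matrix_inv_det P)
  have "P *v (diag3 a1 a2 a3 *v y) = P *v (a *s y)"
    using v(2) P(2) by (simp add: vy matrix_vector_mul_assoc vec.scale)
  then have "matrix_inv P *v (P *v (diag3 a1 a2 a3 *v y)) = matrix_inv P *v (P *v (a *s y))"
    by simp
  then have "diag3 a1 a2 a3 *v y = a *s y"
    by (simp add: matrix_vector_mul_assoc matrix_mul_assoc matrix_inv_det P)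
  then have e: "a1 * y$1 = a * y$1" "a2 * y$2 = a * y$2" "a3 * y$3 = a * y$3"
    unfolding diag3_mult_vec vec_eq_iff forall_3 by simp_all
  have "y \<noteq> 0" using v(1) vy by auto
  then have "y$1 \<noteq> 0 \<or> y$2 \<noteq> 0 \<or> y$3 \<noteq> 0"
    unfolding vec_eq_iff forall_3 by simp
  moreover have
    "v = y$1 *s (P *v axis 1 1)" if "y$2 = 0" "y$3 = 0"
    unfolding vy using that by (simp add: vec_eq_iff matrix_vector_mult_def sum_3 axis_def)
  moreover have
    "v = y$2 *s (P *v axis 2 1)" if "y$1 = 0" "y$3 = 0"
    unfolding vy using that by (simp add: vec_eq_iff matrix_vector_mult_def sum_3 axis_def)
  moreover have
    "v = y$3 *s (P *v axis 3 1)" if "y$1 = 0" "y$2 = 0"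
    unfolding vy using that by (simp add: vec_eq_iff matrix_vector_mult_def sum_3 axis_def)
  ultimately show ?thesis using e d by (metis mult_right_cancel)
qed

text \<open>The strict order makes the \<open>b\<close>'s a permutation of the \<open>a\<close>'s
  that preserves order, hence the identity. This is how absolute values label the
  eigenvalues.\<close>

lemma sorted_triple_eq:
  fixes f :: "'a \<Rightarrow> real"
  assumes "f a1 > f a2" "f a2 > f a3" "f b1 > f b2" "f b2 > f b3"
    and "b1 \<in> {a1, a2, a3}" "b2 \<in> {a1, a2, a3}" "b3 \<in> {a1, a2, a3}"
  shows "b1 = a1" "b2 = a2" "b3 = a3"
  using assms by auto

text \<open>This is the passage from twist and bulge to the gluing matrix. The order of absolute
  values fixes the three eigenlines of \<open>A\<close>; on each of them \<open>K\<close> and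
  \<open>K'\<close> act by the same scalar, and the lines span the space.\<close>

lemma eigenvalues_along_unique:
  assumes "eigenvalues_along A K \<kappa>1 \<kappa>2 \<kappa>3" "eigenvalues_along A K' \<kappa>1 \<kappa>2 \<kappa>3"
  shows "K = K'"
proof -
  obtain a1 a2 a3 v1 v2 v3 where
    a: "cmod a1 > cmod a2" "cmod a2 > cmod a3" and v: "v1 \<noteq> 0" "v2 \<noteq> 0" "v3 \<noteq> 0"
    and Av: "A *v v1 = a1 *s v1" "A *v v2 = a2 *s v2" "A *v v3 = a3 *s v3"
    and Kv: "K *v v1 = \<kappa>1 *s v1" "K *v v2 = \<kappa>2 *s v2" "K *v v3 = \<kappa>3 *s v3"
    using assms(1) unfolding eigenvalues_along_def by blast
  obtain b1 b2 b3 w1 w2 w3 where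
    b: "cmod b1 > cmod b2" "cmod b2 > cmod b3" and w: "w1 \<noteq> 0" "w2 \<noteq> 0" "w3 \<noteq> 0"
    and Aw: "A *v w1 = b1 *s w1" "A *v w2 = b2 *s w2" "A *v w3 = b3 *s w3"
    and Kw: "K' *v w1 = \<kappa>1 *s w1" "K' *v w2 = \<kappa>2 *s w2" "K' *v w3 = \<kappa>3 *s w3"
    using assms(2) unfolding eigenvalues_along_def by blast
  have d: "a1 \<noteq> a2" "a1 \<noteq> a3" "a2 \<noteq> a3" using a by auto
  obtain P where P: "det P \<noteq> 0" "A ** P = P ** diag3 a1 a2 a3"
    and Pv: "P *v axis 1 1 = v1" "P *v axis 2 1 = v2" "P *v axis 3 1 = v3"
    using diagonalize[OF v Av d] by blast
  note E = eigenvector_of_diagonalized[OF P _ _ d, unfolded Pv]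
  have "b1 \<in> {a1, a2, a3}" "b2 \<in> {a1, a2, a3}" "b3 \<in> {a1, a2, a3}"
    using E[OF w(1) Aw(1)] E[OF w(2) Aw(2)] E[OF w(3) Aw(3)] by blast+
  then have "b1 = a1" "b2 = a2" "b3 = a3"
    using sorted_triple_eq[of cmod, OF a b] by blast+
  then obtain c1 c2 c3 where c: "c1 \<noteq> 0" "c2 \<noteq> 0" "c3 \<noteq> 0"
    and wc: "w1 = c1 *s v1" "w2 = c2 *s v2" "w3 = c3 *s v3"
    using E[OF w(1) Aw(1)] E[OF w(2) Aw(2)] E[OF w(3) Aw(3)] d by blast
  \<comment> \<open>The two sets of eigenvectors differ by scalars, which do not affect the
    eigenvalue of \<open>K'\<close> on a line.\<close>
  have K'v: "K' *v v = \<kappa> *s v" if "c \<noteq> 0" "w = c *s v" "K' *v w = \<kappa> *s w" for c \<kappa> v w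
  proof -
    have "c *s (K' *v v) = c *s (\<kappa> *s v)"
      using that by (simp add: vec.scale vector_smult_assoc mult.commute)
    then show ?thesis using that(1) by (simp add: vec.scale_left_imp_eq)
  qed
  have "(K ** P) *v axis i 1 = (K' ** P) *v axis i 1" for i
    using exhaust_3[of i] Kv K'v[OF c(1) wc(1) Kw(1)] K'v[OF c(2) wc(2) Kw(2)] K'v[OF c(3) wc(3) Kw(3)] Pv
    by (auto simp: matrix_vector_mul_assoc[symmetric])
  then have "K ** P = K' ** P"
    by (metis mult_axis vec_eq_iff)
  then have "K ** (P ** matrix_inv P) = K' ** (P ** matrix_inv P)"
    by (simp add: matrix_mul_assoc)
  then show ?thesis by (simp add: matrix_inv_det P)
qed

lemma strongly_loxodromicE:
  assumes "strongly_loxodromic A"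
  obtains P a1 a2 a3 where "det P \<noteq> 0" "A ** P = P ** diag3 a1 a2 a3"
    "cmod a1 > cmod a2" "cmod a2 > cmod a3" "a1 \<noteq> a2" "a1 \<noteq> a3" "a2 \<noteq> a3"
proof -
  obtain a1 a2 a3 v1 v2 v3 where
    a: "cmod a1 > cmod a2" "cmod a2 > cmod a3" and v: "v1 \<noteq> 0" "v2 \<noteq> 0" "v3 \<noteq> 0"
    and Av: "A *v v1 = a1 *s v1" "A *v v2 = a2 *s v2" "A *v v3 = a3 *s v3"
    using assms unfolding strongly_loxodromic_def eigenvalue_def by blast
  have d: "a1 \<noteq> a2" "a1 \<noteq> a3" "a2 \<noteq> a3" using a by auto
  obtain P where "det P \<noteq> 0" "A ** P = P ** diag3 a1 a2 a3"
    using diagonalize[OF v Av d] by metis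
  then show thesis using a d by (rule that)
qed

section \<open>Irreducible pairs up to complex and real conjugation\<close>

definition irreducible_pair :: "complex^3^3 \<Rightarrow> complex^3^3 \<Rightarrow> bool" where
  "irreducible_pair A B \<longleftrightarrow>
     (\<forall>W. vec.subspace W \<and> (\<forall>w\<in>W. A *v w \<in> W \<and> B *v w \<in> W) \<longrightarrow> W = {0} \<or> W = UNIV)"

text \<open>If no entry of \<open>b\<close> leads out of a proper nonempty \<open>I\<close>, the
  eigenvectors of \<open>A\<close> with index in \<open>I\<close> span an invariant subspace
  \<open>W\<close>. An index in \<open>I\<close> shows that \<open>W\<close> is nonzero, an index
  outside \<open>I\<close> that it is proper.\<close>

lemma irreducible_pair_strongly_connected3:
  assumes P: "det P \<noteq> 0" and A: "A ** P = P ** diag3 a1 a2 a3" and B: "B ** P = P ** b"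
    and irr: "irreducible_pair A B"
  shows "strongly_connected3 b"
  unfolding strongly_connected3_def
proof (intro allI impI, rule ccontr)
  fix I :: "3 set"
  assume I: "I \<noteq> {}" "I \<noteq> UNIV" and n: "\<not> (\<exists>i\<in>-I. \<exists>j\<in>I. b$i$j \<noteq> 0)"
  define W where "W = (*v) P ` {x. \<forall>i\<in>-I. x$i = 0}"
  have "vec.subspace {x::complex^3. \<forall>i\<in>-I. x$i = 0}"
    by (auto simp: vec.subspace_def)
  then have "vec.subspace W"
    unfolding W_def by (rule vec.subspace_image)
  moreover have "A *v w \<in> W \<and> B *v w \<in> W" if wW: "w \<in> W" for w
  proof -
    obtain x where x: "w = P *v x" "\<forall>i\<in>-I. x$i = 0" using wW unfolding W_def by blast
    have "A *v w = P *v (diag3 a1 a2 a3 *v x)" "B *v w = P *v (b *v x)"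
      using A B by (simp_all add: x matrix_vector_mul_assoc)
    moreover have "(diag3 a1 a2 a3 *v x)$i = 0" if "i \<in> -I" for i
    proof -
      have "x$i = 0" using x(2) that by blast
      then show ?thesis
        using exhaust_3[of i] by (auto simp: diag3_mult_vec)
    qed
    moreover have "\<forall>i\<in>-I. (b *v x)$i = 0"
      unfolding matrix_vector_mult_def using n x(2)
      by (auto intro!: sum.neutral)
    ultimately show ?thesis by (auto simp: W_def)
  qed
  ultimately have "W = {0} \<or> W = UNIV"
    using irr unfolding irreducible_pair_def by blast
  moreover have inj: "x = y" if "P *v x = P *v y" for x y
    using that P by (metis matrix_inv_det(2) matrix_vector_mul_assoc matrix_vector_mul_lid)
  obtain j where j: "j \<in> I" using I by blast
  have "P *v axis j 1 \<in> W"
    unfolding W_def by (rule imageI) (use j in \<open>auto simp: axis_def\<close>)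
  moreover have "P *v axis j 1 \<noteq> 0"
    using inj[of "axis j 1" 0] by (auto simp: matrix_vector_mult_0_right axis_eq_0_iff)
  ultimately have "W = UNIV" by auto
  obtain i where i: "i \<notin> I" using I by blast
  have "P *v axis i 1 \<in> W" using \<open>W = UNIV\<close> by simp
  then obtain x where "P *v axis i 1 = P *v x" "\<forall>i\<in>-I. x$i = 0" by (auto simp: W_def)
  with inj have "axis i (1::complex) $ i = 0" using i by (metis ComplI)
  then show False by (simp add: axis_def)
qed

text \<open>The hypotheses equate the elementary symmetric functions, so the two cubics have the
  same roots. For determinant one the second symmetric function is the trace of the inverse.\<close>

lemma eigenvalues_determined:
  fixes a1 a2 a3 b1 b2 b3 :: complex
  assumes "a1 * a2 * a3 = b1 * b2 * b3" "a1 + a2 + a3 = b1 + b2 + b3"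
    and "a2 * a3 + a1 * a3 + a1 * a2 = b2 * b3 + b1 * b3 + b1 * b2"
    and "cmod a1 > cmod a2" "cmod a2 > cmod a3" "cmod b1 > cmod b2" "cmod b2 > cmod b3"
  shows "b1 = a1" "b2 = a2" "b3 = a3"
proof -
  have *: "(x - a1) * (x - a2) * (x - a3) = (x - b1) * (x - b2) * (x - b3)" for x
  proof -
    have e: "(x - c1) * (x - c2) * (x - c3) =
      x^3 - (c1 + c2 + c3) * x^2 + (c2 * c3 + c1 * c3 + c1 * c2) * x - c1 * c2 * c3" for c1 c2 c3
      by (simp add: algebra_simps power2_eq_square power3_eq_cube)
    show ?thesis unfolding e assms(1-3) ..
  qed
  have "b1 \<in> {a1, a2, a3}" "b2 \<in> {a1, a2, a3}" "b3 \<in> {a1, a2, a3}"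
    using *[of b1] *[of b2] *[of b3] by auto
  then show "b1 = a1" "b2 = a2" "b3 = a3"
    using sorted_triple_eq[of cmod, OF assms(4-7)] by blast+
qed

lemma trace_conj:
  fixes P X :: "'a::field^'n^'n"
  assumes "det P \<noteq> 0"
  shows "trace (matrix_inv P ** X ** P) = trace X"
proof -
  have "trace (matrix_inv P ** X ** P) = trace (P ** matrix_inv P ** X)"
    by (subst trace_mul_sym) (simp add: matrix_mul_assoc)
  then show ?thesis by (simp add: matrix_inv_det assms)
qed

lemma conj_mult:
  fixes P X Y :: "'a::field^'n^'n"
  assumes "det P \<noteq> 0"
  shows "matrix_inv P ** (X ** Y) ** P = (matrix_inv P ** X ** P) ** (matrix_inv P ** Y ** P)"
proof -
  have "(matrix_inv P ** X ** P) ** (matrix_inv P ** Y ** P) = matrix_inv P ** X ** (P ** matrix_inv P) ** Y ** P"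
    by (simp only: matrix_mul_assoc)
  then show ?thesis by (simp add: matrix_inv_det assms matrix_mul_assoc)
qed

lemma det_conj:
  fixes P X :: "'a::field^'n^'n"
  assumes "det P \<noteq> 0"
  shows "det (matrix_inv P ** X ** P) = det X"
  using assms by (simp add: det_mul det_matrix_inv)

lemma det_diag3: "det (diag3 a b c) = a * b * (c::'a::comm_ring_1)"
  by (simp add: det_3 diag3_def)

lemma adj3_diag3: "adj3 (diag3 a b c) = diag3 (b * c) (a * c) (a * (b::'a::comm_ring_1))"
  unfolding vec_eq_iff forall_3 by (simp add: adj3_def diag3_def)

lemma conj_inv:
  fixes P X :: "'a::field^3^3"
  assumes P: "det P \<noteq> 0" and X: "det X = 1"
  shows "matrix_inv P ** matrix_inv X ** P = adj3 (matrix_inv P ** X ** P)"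
proof -
  have "det (matrix_inv P ** X ** P) = 1" using det_conj[OF P] X by simp
  then have "adj3 (matrix_inv P ** X ** P) = matrix_inv (matrix_inv P ** X ** P)"
    by (simp add: matrix_inv_adj3)
  also have "\<dots> = matrix_inv P ** matrix_inv X ** P"
    by (rule matrix_inv_eqI) (simp add: conj_mult[OF P, symmetric] matrix_inv_det X P)
  finally show ?thesis by simp
qed

text \<open>Both \<open>A\<close> and \<open>A'\<close> are brought to the same ordered diagonal
  form, while \<open>B\<close> and \<open>B'\<close> become \<open>b\<close> and \<open>c\<close>
  with equal cycle products. A diagonal \<open>D\<close> with \<open>c D = D b\<close> commutes with
  that form, so following \<open>P\<close> backwards, then \<open>D\<close>, then \<open>P'\<close>
  gives the conjugating matrix \<open>h\<close>.\<close>

lemma irreducible_pair_determined: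
  fixes A B A' B' :: "complex^3^3"
  assumes det: "det A = 1" "det B = 1" "det A' = 1" "det B' = 1"
    and lox: "strongly_loxodromic A" "strongly_loxodromic A'"
    and irr: "irreducible_pair A B" "irreducible_pair A' B'"
    and tr: "trace A = trace A'" "trace (matrix_inv A) = trace (matrix_inv A')"
      "trace B = trace B'" "trace (matrix_inv B) = trace (matrix_inv B')"
      "trace (A ** B) = trace (A' ** B')"
      "trace (matrix_inv A ** matrix_inv B) = trace (matrix_inv A' ** matrix_inv B')"
      "trace (matrix_inv A ** B) = trace (matrix_inv A' ** B')"
      "trace (A ** matrix_inv B) = trace (A' ** matrix_inv B')"
      "trace (commutator A B) = trace (commutator A' B')"
  obtains h where "det h \<noteq> 0" "A' ** h = h ** A" "B' ** h = h ** B"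
proof -
  obtain P a1 a2 a3 where P: "det P \<noteq> 0" "A ** P = P ** diag3 a1 a2 a3"
    and a: "cmod a1 > cmod a2" "cmod a2 > cmod a3" "a1 \<noteq> a2" "a1 \<noteq> a3" "a2 \<noteq> a3"
    using strongly_loxodromicE[OF lox(1)] by metis
  obtain P' a1' a2' a3' where P': "det P' \<noteq> 0" "A' ** P' = P' ** diag3 a1' a2' a3'"
    and a': "cmod a1' > cmod a2'" "cmod a2' > cmod a3'" "a1' \<noteq> a2'" "a1' \<noteq> a3'" "a2' \<noteq> a3'"
    using strongly_loxodromicE[OF lox(2)] by metis
  define f where "f = (\<lambda>X. matrix_inv P ** X ** P)"
  define f' where "f' = (\<lambda>X. matrix_inv P' ** X ** P')"
  have f: "f (X ** Y) = f X ** f Y" "trace (f X) = trace X" for X Y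
    using conj_mult[OF P(1)] trace_conj[OF P(1)] by (auto simp: f_def)
  have f': "f' (X ** Y) = f' X ** f' Y" "trace (f' X) = trace X" for X Y
    using conj_mult[OF P'(1)] trace_conj[OF P'(1)] by (auto simp: f'_def)
  have fA: "f A = diag3 a1 a2 a3"
    using P by (simp add: f_def matrix_mul_assoc[symmetric]) (simp add: matrix_mul_assoc matrix_inv_det)
  have fA': "f' A' = diag3 a1' a2' a3'"
    using P' by (simp add: f'_def matrix_mul_assoc[symmetric]) (simp add: matrix_mul_assoc matrix_inv_det)
  have df: "det (f X) = det X" "det (f' X) = det X" for X
    using det_conj P P' by (auto simp: f_def f'_def)
  have fi: "f (matrix_inv X) = adj3 (f X)" "f' (matrix_inv X) = adj3 (f' X)" if "det X = 1" for X
    using conj_inv that P P' by (auto simp: f_def f'_def)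
  have pa: "a1 * a2 * a3 = 1" "a1' * a2' * a3' = 1"
    using df[of A] df[of A'] by (simp_all add: fA fA' det det_diag3)
  have fAi: "f (matrix_inv A) = diag3 (a2 * a3) (a1 * a3) (a1 * a2)"
    by (simp add: fi det fA adj3_diag3)
  have fAi': "f' (matrix_inv A') = diag3 (a2' * a3') (a1' * a3') (a1' * a2')"
    by (simp add: fi det fA' adj3_diag3)
  have "trace (f A) = trace (f' A')" "trace (f (matrix_inv A)) = trace (f' (matrix_inv A'))"
    using tr by (simp_all add: f f')
  \<comment> \<open>From here on both pairs share one diagonal matrix, so that \<open>b\<close> and
    \<open>c\<close> are compared with the same weights.\<close>
  then have "a1' = a1" "a2' = a2" "a3' = a3"
    unfolding fA fA' fAi fAi'
    using eigenvalues_determined[OF _ _ _ a(1,2) a'(1,2)] pa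
    by (simp_all add: trace_def sum_3 diag3_def)
  note fA' = fA'[unfolded this] and fAi' = fAi'[unfolded this] and P' = P'[unfolded this]
  define b c where "b = f B" and "c = f' B'"
  have db: "det b = 1" "det c = 1" using det by (simp_all add: b_def c_def df)
  have bi: "f (matrix_inv B) = adj3 b" "f' (matrix_inv B') = adj3 c"
    by (simp_all add: fi det b_def c_def)
  have B: "B ** P = P ** b" "B' ** P' = P' ** c"
    by (simp_all add: b_def c_def f_def f'_def matrix_mul_assoc matrix_inv_det P P')
  have t: "trace (f X) = trace (f' Y)" if "trace X = trace Y" for X Y
    using that by (simp add: f f')
  note T = tr(3-9)[THEN t]
  have sc: "strongly_connected3 b" "strongly_connected3 c"
    using irreducible_pair_strongly_connected3 P P' B irr by blast+
  \<comment> \<open>The traces are fed in as those of \<open>B\<close>, \<open>A B\<close> and the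
    inverse of \<open>A\<close> times \<open>B\<close>, then the same three with the inverse of
    \<open>B\<close>, and finally the commutator.\<close>
  note C = cycle_products_eq[OF a(3-5) db
      T(1)[folded b_def c_def]
      T(3)[unfolded f f' fA fA', folded b_def c_def]
      T(5)[unfolded f f' fAi fAi', folded b_def c_def]
      T(2)[unfolded bi]
      T(6)[unfolded f f' bi fA fA']
      T(4)[unfolded f f' bi fAi fAi']
      T(7)[unfolded commutator_def f f' bi fA fA' fAi fAi', folded b_def c_def]]
  obtain d1 d2 d3 where d: "d1 \<noteq> 0" "d2 \<noteq> 0" "d3 \<noteq> 0"
    and cd: "c ** diag3 d1 d2 d3 = diag3 d1 d2 d3 ** b"
    using cycle_products_determine[OF sc C] by blast
  define D where "D = diag3 d1 d2 d3"
  have AD: "diag3 a1 a2 a3 ** D = D ** diag3 a1 a2 a3"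
    unfolding vec_eq_iff forall_3 by (simp add: D_def diag3_def matrix_matrix_mult_def sum_3)
  define h where "h = P' ** D ** matrix_inv P"
  have "det D \<noteq> 0" using d by (simp add: D_def det_diag3)
  then have "det h \<noteq> 0"
    using P P' by (simp add: h_def det_mul det_matrix_inv)
  moreover have inter: "X' ** h = h ** X"
    if X: "X ** P = P ** y" "X' ** P' = P' ** y'" "y' ** D = D ** y" for X X' y y'
  proof -
    have "X' ** h = (X' ** P') ** D ** matrix_inv P"
      by (simp add: h_def matrix_mul_assoc)
    also have "\<dots> = P' ** (y' ** D) ** matrix_inv P"
      by (simp only: X(2) matrix_mul_assoc)
    also have "\<dots> = P' ** (D ** y) ** matrix_inv P"
      by (simp only: X)
    also have "\<dots> = P' ** D ** (matrix_inv P ** P) ** y ** matrix_inv P"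
      by (simp add: matrix_mul_assoc matrix_inv_det P)
    also have "\<dots> = P' ** D ** matrix_inv P ** (P ** y) ** matrix_inv P"
      by (simp add: matrix_mul_assoc)
    also have "\<dots> = h ** X ** (P ** matrix_inv P)"
      by (simp only: X(1)[symmetric] h_def matrix_mul_assoc)
    also have "\<dots> = h ** X" by (simp add: matrix_inv_det P)
    finally show ?thesis .
  qed
  moreover have "A' ** h = h ** A" by (rule inter[OF P(2) P'(2) AD])
  moreover have "B' ** h = h ** B" by (rule inter[OF B cd[folded D_def]])
  ultimately show thesis using that by blast
qed

text \<open>The polynomial \<open>det (Re h + z Im h)\<close> does not vanish at \<open>z = i\<close>, hence neither at some real
  \<open>z\<close>.\<close>

lemma real_intertwiner:
  fixes h :: "complex^3^3"
  assumes h: "det h \<noteq> 0" and int: "\<And>i. i \<in> I \<Longrightarrow> X' i ** h = h ** X i"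
    and re: "\<And>i. i \<in> I \<Longrightarrow> real_entries (X i)" "\<And>i. i \<in> I \<Longrightarrow> real_entries (X' i)"
  obtains k where "k \<in> SL3R" "\<And>i. i \<in> I \<Longrightarrow> X' i ** k = k ** X i"
proof -
  \<comment> \<open>For real \<open>X i\<close> and \<open>X' i\<close> the entrywise real and
    imaginary parts of \<open>h\<close> intertwine separately, so every real combination of them
    does too.\<close>
  define H where "H = (\<lambda>z::complex. (\<chi> i j. of_real (Re (h$i$j)) + z * of_real (Im (h$i$j))) :: complex^3^3)"
  define p where "p = det ((\<chi> i j. [:complex_of_real (Re (h$i$j)), of_real (Im (h$i$j)):]) :: complex poly ^3^3)"
  have pz: "poly p z = det (H z)" for z
    by (simp add: p_def H_def det_3 algebra_simps)
  have "H \<i> = h"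
    unfolding H_def vec_eq_iff by (simp add: complex_eq_iff)
  with h pz have "p \<noteq> 0" by (metis poly_0)
  then have "finite {z. poly p z = 0}" by (rule poly_roots_finite)
  then have "\<not> range complex_of_real \<subseteq> {z. poly p z = 0}"
    by (meson finite_subset infinite_UNIV_char_0 finite_imageD inj_of_real)
  then obtain r where r: "det (H (complex_of_real r)) \<noteq> 0"
    using pz by auto
  define q where "q = H (complex_of_real r)"
  have rq: "q$i$j = of_real (Re (h$i$j) + r * Im (h$i$j))" for i j
    by (simp add: q_def H_def)
  have "det q \<in> \<real>" by (simp add: det_3 rq)
  then obtain d where d: "det q = complex_of_real d" by (auto elim: Reals_cases)
  have d0: "d \<noteq> 0" using r d by (auto simp: q_def)
  \<comment> \<open>Scaling by \<open>c\<close> multiplies a 3 by 3 determinant by the cube of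
    \<open>c\<close>. A real cube root exists for either sign of \<open>d\<close>, so the
    normalisation to determinant one stays real.\<close>
  define c where "c = 1 / root 3 d"
  have c3: "c * c * c * d = 1"
    using odd_real_root_pow[of 3 d] d0 by (simp add: c_def power3_eq_cube)
  define k :: "complex^3^3" where "k = (\<chi> i j. complex_of_real c * q$i$j)"
  have "det k = of_real (c * c * c) * det q"
    by (simp add: k_def det_3 algebra_simps)
  also have "\<dots> = of_real (c * c * c * d)" unfolding d by simp
  also have "\<dots> = 1" unfolding c3 by simp
  finally have "k \<in> SL3R"
    by (auto simp: SL3R_def real_entries_def k_def rq)
  moreover have "X' i ** k = k ** X i" if i: "i \<in> I" for i
  proof -
    have R: "Im (X i $ m $ n) = 0" "Im (X' i $ m $ n) = 0" for m n
      using re[OF i] by (simp_all add: real_entries_def complex_is_Real_iff)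
    have e: "(X' i ** h)$m$n = (h ** X i)$m$n" for m n
      using int[OF i] by simp
    have "Re ((X' i ** h)$m$n) = Re ((h ** X i)$m$n)" "Im ((X' i ** h)$m$n) = Im ((h ** X i)$m$n)" for m n
      by (simp_all add: e)
    then have E: "(\<Sum>l\<in>UNIV. Re (X' i $ m $ l) * Re (h $ l $ n)) = (\<Sum>l\<in>UNIV. Re (h $ m $ l) * Re (X i $ l $ n))"
      "(\<Sum>l\<in>UNIV. Re (X' i $ m $ l) * Im (h $ l $ n)) = (\<Sum>l\<in>UNIV. Im (h $ m $ l) * Re (X i $ l $ n))" for m n
      by (simp_all add: matrix_matrix_mult_def R)
    have "Re ((X' i ** k)$m$n) = c * ((\<Sum>l\<in>UNIV. Re (X' i $ m $ l) * Re (h $ l $ n)) + r * (\<Sum>l\<in>UNIV. Re (X' i $ m $ l) * Im (h $ l $ n)))"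
      "Re ((k ** X i)$m$n) = c * ((\<Sum>l\<in>UNIV. Re (h $ m $ l) * Re (X i $ l $ n)) + r * (\<Sum>l\<in>UNIV. Im (h $ m $ l) * Re (X i $ l $ n)))"
      "Im ((X' i ** k)$m$n) = 0" "Im ((k ** X i)$m$n) = 0" for m n
      by (simp_all add: matrix_matrix_mult_def k_def rq R sum_3 algebra_simps)
    then show ?thesis by (simp add: vec_eq_iff complex_eq_iff E)
  qed
  ultimately show thesis using that by blast
qed

section \<open>Words in generators and change of base point\<close>

lemma word_val_Nil [simp]: "word_val G x [] = \<one>\<^bsub>G\<^esub>"
  by (simp add: word_val_def)

lemma word_val_Cons [simp]:
  "word_val G x ((i, e) # w) = (if e then x i else inv\<^bsub>G\<^esub> (x i)) \<otimes>\<^bsub>G\<^esub> word_val G x w"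
  by (simp add: word_val_def)

lemma presented_by_induct:
  assumes G: "group G" and pres: "presented_by G I x R" and y: "y \<in> carrier G"
    and one: "P \<one>\<^bsub>G\<^esub>"
    and gen: "\<And>i z. i \<in> I \<Longrightarrow> z \<in> carrier G \<Longrightarrow> P z \<Longrightarrow> P (x i \<otimes>\<^bsub>G\<^esub> z)"
    and inv: "\<And>i z. i \<in> I \<Longrightarrow> z \<in> carrier G \<Longrightarrow> P z \<Longrightarrow> P (inv\<^bsub>G\<^esub> (x i) \<otimes>\<^bsub>G\<^esub> z)"
  shows "P y"
proof -
  interpret group G by fact
  have x: "x i \<in> carrier G" if "i \<in> I" for i
    using pres that by (auto simp: presented_by_def)
  have "word_val G x w \<in> carrier G \<and> P (word_val G x w)" if "w \<in> lists (I \<times> UNIV)" for w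
    using that
  proof induction
    case (Cons l w)
    obtain i e where "l = (i, e)" by (cases l)
    with Cons x gen inv show ?case by auto
  qed (use one in simp)
  moreover obtain w where "w \<in> lists (I \<times> UNIV)" "y = word_val G x w"
    using pres y unfolding presented_by_def by blast
  ultimately show ?thesis by blast
qed

lemma presented_by_hom_eqI:
  assumes G: "group G" and H: "group H" and f: "f \<in> hom G H" and f': "f' \<in> hom G H"
    and pres: "presented_by G I x R" and eq: "\<And>i. i \<in> I \<Longrightarrow> f (x i) = f' (x i)"
    and y: "y \<in> carrier G"
  shows "f y = f' y"
proof -
  interpret f: group_hom G H f using G H f by (simp add: group_hom_def group_hom_axioms_def)
  interpret f': group_hom G H f' using G H f' by (simp add: group_hom_def group_hom_axioms_def)
  have x: "x i \<in> carrier G" if "i \<in> I" for i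
    using pres that by (auto simp: presented_by_def)
  show ?thesis
    using G pres y
    by (rule presented_by_induct) (auto simp: x eq)
qed

lemma presented_by_relator:
  assumes pres: "presented_by G I x R" and r: "r \<in> R" "r \<in> lists (I \<times> UNIV)"
  shows "word_val G x r = \<one>\<^bsub>G\<^esub>"
proof -
  have "elementary_move I R ([] @ r @ []) ([] @ [])"
    by (rule elementary_move.relator) fact
  then have "equivclp (elementary_move I R) r []"
    by (simp add: r_into_equivclp)
  then show ?thesis
    using pres r(2) unfolding presented_by_def by blast
qed

section \<open>Transport of loops along a path\<close>

lemma loops_atD:
  assumes "l \<in> loops_at X x"
  shows "path l" "path_image l \<subseteq> X" "pathstart l = x" "pathfinish l = x"
  using assms by (auto simp: loops_at_def)

lemma loops_at_conj:
  assumes "path p" "path_image p \<subseteq> S" "pathstart p = x" "pathfinish p = y"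
    and "l \<in> loops_at Y y" "Y \<subseteq> S"
  shows "p +++ l +++ reversepath p \<in> loops_at S x"
  using assms by (auto simp: loops_at_def path_image_join)

lemma homotopic_paths_conj_join:
  assumes p: "path p" "path_image p \<subseteq> S" "pathfinish p = y"
    and l: "l \<in> loops_at S y" and l': "l' \<in> loops_at S y"
  shows "homotopic_paths S ((p +++ l +++ reversepath p) +++ (p +++ l' +++ reversepath p))
           (p +++ (l +++ l') +++ reversepath p)"
proof -
  define r where "r = reversepath p"
  define m where "m = l' +++ r"
  have r: "path r" "path_image r \<subseteq> S" "pathstart r = y" "pathfinish r = pathstart p"
    using p by (auto simp: r_def)
  note L = loops_atD[OF l] and L' = loops_atD[OF l']
  have m: "path m" "path_image m \<subseteq> S" "pathstart m = y" "pathfinish m = pathstart p"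
    using r L' by (auto simp: m_def path_image_join)
  note facts = p r m L L'
  have "homotopic_paths S (r +++ (p +++ m)) ((r +++ p) +++ m)"
    by (rule homotopic_paths_assoc) (use facts in auto)
  also have "homotopic_paths S ((r +++ p) +++ m) ((\<lambda>_. y) +++ m)"
    by (rule homotopic_paths_join) (use facts homotopic_paths_reverse_join[of p S] in \<open>auto simp: r_def\<close>)
  also have "homotopic_paths S ((\<lambda>_. y) +++ m) m"
    using homotopic_paths_const_left[of m S] facts by simp
  finally (homotopic_paths_trans) have 1: "homotopic_paths S (r +++ (p +++ m)) m" .
  have "homotopic_paths S ((l +++ r) +++ (p +++ m)) (l +++ (r +++ (p +++ m)))"
    by (rule homotopic_paths_sym, rule homotopic_paths_assoc) (use facts in \<open>auto simp: path_image_join\<close>)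
  also have "homotopic_paths S (l +++ (r +++ (p +++ m))) (l +++ m)"
    by (rule homotopic_paths_join) (use facts 1 in auto)
  also have "homotopic_paths S (l +++ m) ((l +++ l') +++ r)"
    unfolding m_def by (rule homotopic_paths_assoc) (use facts in auto)
  finally (homotopic_paths_trans) have 2: "homotopic_paths S ((l +++ r) +++ (p +++ m)) ((l +++ l') +++ r)" .
  have "homotopic_paths S ((p +++ (l +++ r)) +++ (p +++ m)) (p +++ ((l +++ r) +++ (p +++ m)))"
    by (rule homotopic_paths_sym, rule homotopic_paths_assoc) (use facts in \<open>auto simp: path_image_join\<close>)
  also have "homotopic_paths S (p +++ ((l +++ r) +++ (p +++ m))) (p +++ ((l +++ l') +++ r))"
    by (rule homotopic_paths_join) (use facts 2 in auto)
  finally (homotopic_paths_trans) show ?thesis by (simp add: r_def m_def)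
qed

text \<open>Inclusion of \<open>Y\<close> into \<open>S\<close> followed by the change of base point
  along \<open>p\<close>.\<close>

lemma conj_path_hom:
  fixes S Y :: "'a::topological_space set"
  assumes p: "path p" "path_image p \<subseteq> S" "pathstart p = x" "pathfinish p = y" and YS: "Y \<subseteq> S"
  obtains \<Phi> where "\<Phi> \<in> hom (pi1 Y y) (pi1 S x)"
    "\<And>l. l \<in> loops_at Y y \<Longrightarrow> \<Phi> (path_class Y l) = path_class S (p +++ l +++ reversepath p)"
proof -
  define c where "c = (\<lambda>l. path_class S (p +++ l +++ reversepath p))"
  \<comment> \<open>A group element is itself a set of paths, and \<open>c\<close> sends all of its
    members to one class. The union of these equal sets is therefore that class, and no
    representative has to be chosen.\<close>
  define \<Phi> where "\<Phi> = (\<lambda>A. \<Union>l\<in>A. c l)"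
  have ceq: "c l = c l'" if "homotopic_paths Y l l'" "l \<in> loops_at Y y" for l l'
  proof -
    have "homotopic_paths S l l'" using homotopic_paths_subset that YS by blast
    moreover have "pathfinish l' = y" "pathstart l' = y"
      using that homotopic_paths_imp_pathfinish homotopic_paths_imp_pathstart loops_atD by metis+
    ultimately show ?thesis
      unfolding c_def
      by (intro path_class_eqI homotopic_paths_join)
        (use p loops_atD[OF that(2)] in auto)
  qed
  have \<Phi>: "\<Phi> (path_class Y l) = c l" if l: "l \<in> loops_at Y y" for l
  proof -
    have "l \<in> path_class Y l"
      using loops_atD[OF l] by (simp add: path_class_def)
    moreover have "c l' = c l" if "l' \<in> path_class Y l" for l'
      using ceq[of l l'] that l by (simp add: path_class_def)
    ultimately show ?thesis unfolding \<Phi>_def by blast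
  qed
  have lS: "p +++ l +++ reversepath p \<in> loops_at S x" if "l \<in> loops_at Y y" for l
    by (rule loops_at_conj[OF p that YS])
  have sub: "l \<in> loops_at S y" if "l \<in> loops_at Y y" for l
    using that YS by (auto simp: loops_at_def)
  have "\<Phi> \<in> hom (pi1 Y y) (pi1 S x)"
  proof (rule homI)
    fix A assume "A \<in> carrier (pi1 Y y)"
    then obtain l where l: "l \<in> loops_at Y y" "A = path_class Y l" by (auto simp: pi1_def)
    then show "\<Phi> A \<in> carrier (pi1 S x)"
      using lS[OF l(1)] by (simp add: \<Phi> c_def) (simp add: pi1_def)
    fix B assume "B \<in> carrier (pi1 Y y)"
    then obtain l' where l': "l' \<in> loops_at Y y" "B = path_class Y l'" by (auto simp: pi1_def)
    show "\<Phi> (A \<otimes>\<^bsub>pi1 Y y\<^esub> B) = \<Phi> A \<otimes>\<^bsub>pi1 S x\<^esub> \<Phi> B"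
      using l l' lS homotopic_paths_conj_join[OF p(1,2,4) sub sub, of l l']
      by (simp add: pi1_mult \<Phi> loops_at_join c_def path_class_eqI homotopic_paths_sym_eq)
  qed
  then show thesis using that \<Phi> unfolding c_def by blast
qed

lemma group_SL3C: "group SL3C"
proof (rule groupI)
  fix A assume "A \<in> carrier SL3C"
  then have d: "det A = 1" by (simp add: SL3C_def)
  then obtain B where B: "B ** A = mat 1" using invertible_det_nz[of A] unfolding invertible_def by auto
  then have "det B = 1" using d by (metis det_I det_mul mult.right_neutral)
  with B show "\<exists>B\<in>carrier SL3C. B \<otimes>\<^bsub>SL3C\<^esub> A = \<one>\<^bsub>SL3C\<^esub>"
    by (auto simp: SL3C_def)
qed (auto simp: SL3C_def det_mul matrix_mul_assoc)

section \<open>Representations of a marked surface\<close>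

lemma inv_SL3C:
  assumes "A \<in> carrier SL3C"
  shows "inv\<^bsub>SL3C\<^esub> A = matrix_inv A"
proof -
  interpret group SL3C by (rule group_SL3C)
  have d: "det A = 1" using assms by (simp add: SL3C_def)
  show ?thesis
    by (rule inv_equality) (use d in \<open>auto simp: SL3C_def matrix_inv_det det_matrix_inv\<close>)
qed

lemma conj_in_hom_SL3C:
  assumes f: "f \<in> hom G SL3C" and h: "det h = 1"
  shows "(\<lambda>x. h ** f x ** matrix_inv h) \<in> hom G SL3C"
proof (rule homI)
  fix x y assume x: "x \<in> carrier G" and y: "y \<in> carrier G"
  have "det (f x) = 1" using hom_in_carrier[OF f x] by (simp add: SL3C_def)
  then show "h ** f x ** matrix_inv h \<in> carrier SL3C"
    using h by (simp add: SL3C_def det_mul det_matrix_inv)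
  have "h ** (f x ** f y) ** matrix_inv h = h ** f x ** (matrix_inv h ** h) ** f y ** matrix_inv h"
    using h by (simp add: matrix_inv_det matrix_mul_assoc)
  then show "h ** f (x \<otimes>\<^bsub>G\<^esub> y) ** matrix_inv h =
      (h ** f x ** matrix_inv h) \<otimes>\<^bsub>SL3C\<^esub> (h ** f y ** matrix_inv h)"
    using hom_mult[OF f x y] by (simp add: SL3C_def matrix_mul_assoc)
qed

text \<open>An injective map of a finite-dimensional \<open>W\<close> into itself is onto, so the
  preimage of each \<open>w\<close> already lies in \<open>W\<close>.\<close>

lemma matrix_inv_invariant:
  fixes A :: "'a::field^'n^'n"
  assumes "det A \<noteq> 0" "vec.subspace W" and inv: "\<And>w. w \<in> W \<Longrightarrow> A *v w \<in> W"
    and w: "w \<in> W"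
  shows "matrix_inv A *v w \<in> W"
proof -
  have inj: "inj ((*v) A)"
    by (rule inj_on_inverseI[of _ "(*v) (matrix_inv A)"])
      (simp add: matrix_vector_mul_assoc matrix_inv_det assms)
  have "(*v) A ` W = W"
  proof (rule vec.subspace_dim_equal)
    show "vec.subspace ((*v) A ` W)" by (rule vec.subspace_image) fact
    show "vec.dim W \<le> vec.dim ((*v) A ` W)"
      by (subst vec.dim_image_eq) (use inj in \<open>auto simp: inj_on_def inj_def\<close>)
  qed (use assms in auto)
  then obtain u where "u \<in> W" "w = A *v u" using w by auto
  then show ?thesis
    by (simp add: matrix_vector_mul_assoc matrix_inv_det assms)
qed

lemma eigenvalue_conj:
  assumes "eigenvalue A c" "det h \<noteq> 0"
  shows "eigenvalue (h ** A ** matrix_inv h) c"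
proof -
  obtain v where v: "v \<noteq> 0" "A *v v = c *s v" using assms(1) by (auto simp: eigenvalue_def)
  have "matrix_inv h *v (h *v v) = v"
    using assms(2) by (simp add: matrix_vector_mul_assoc matrix_inv_det)
  moreover from this have "h *v v \<noteq> 0" using v(1) by (metis vec.zero)
  ultimately show ?thesis
    unfolding eigenvalue_def using v(2)
    by (intro exI[of _ "h *v v"]) (simp add: matrix_vector_mul_assoc[symmetric] vec.scale)
qed

lemma strongly_loxodromic_conj:
  "strongly_loxodromic A \<Longrightarrow> det h \<noteq> 0 \<Longrightarrow> strongly_loxodromic (h ** A ** matrix_inv h)"
  unfolding strongly_loxodromic_def using eigenvalue_conj by blast

text \<open>Inversion turns the eigenvalues into their reciprocals and reverses the order of
  absolute values. It is needed because the second side of a curve carries a conjugate of the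
  inverse of the first.\<close>

lemma strongly_loxodromic_inv:
  assumes "strongly_loxodromic A" and d: "det A \<noteq> 0"
  shows "strongly_loxodromic (matrix_inv A)"
proof -
  have e: "c \<noteq> 0 \<and> eigenvalue (matrix_inv A) (1 / c)" if c: "eigenvalue A c" for c
  proof -
    obtain v where v: "v \<noteq> 0" "A *v v = c *s v" using c by (auto simp: eigenvalue_def)
    have "v = matrix_inv A *v (A *v v)" using d by (simp add: matrix_vector_mul_assoc matrix_inv_det)
    then have "v = c *s (matrix_inv A *v v)" by (simp add: v(2) vec.scale)
    moreover from this have "c \<noteq> 0" using v(1) by auto
    ultimately have "matrix_inv A *v v = (1 / c) *s v"
      by (metis divide_self_if vec.scale_one vec.scale_scale times_divide_eq_left mult_1)
    with v \<open>c \<noteq> 0\<close> show ?thesis by (auto simp: eigenvalue_def)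
  qed
  obtain a b c where "eigenvalue A a" "eigenvalue A b" "eigenvalue A c"
    and abc: "cmod a > cmod b" "cmod b > cmod c"
    using assms(1) unfolding strongly_loxodromic_def by blast
  with e have "c \<noteq> 0" "b \<noteq> 0" and E: "eigenvalue (matrix_inv A) (1 / c)" "eigenvalue (matrix_inv A) (1 / b)"
    "eigenvalue (matrix_inv A) (1 / a)" by blast+
  have "cmod (1 / c) > cmod (1 / b)" "cmod (1 / b) > cmod (1 / a)"
    using abc \<open>c \<noteq> 0\<close> \<open>b \<noteq> 0\<close> by (auto simp: norm_divide intro!: divide_strict_left_mono mult_pos_pos)
  with E show ?thesis unfolding strongly_loxodromic_def by blast
qed

lemma irreducible_on_conj:
  assumes irr: "irreducible_on D \<rho>" and d: "det h \<noteq> 0"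
    and \<rho>': "\<And>x. x \<in> D \<Longrightarrow> \<rho>' x = h ** \<rho> x ** matrix_inv h"
  shows "irreducible_on D \<rho>'"
  unfolding irreducible_on_def
proof (intro allI impI)
  fix W :: "(complex^3) set" assume W: "vec.subspace W \<and> (\<forall>x\<in>D. \<forall>w\<in>W. \<rho>' x *v w \<in> W)"
  define V where "V = (*v) (matrix_inv h) ` W"
  have hV: "(*v) h ` V = W"
    using d by (simp add: V_def image_image matrix_vector_mul_assoc matrix_inv_det)
  have "vec.subspace V" unfolding V_def by (rule vec.subspace_image) (use W in blast)
  moreover have "\<rho> x *v v \<in> V" if x: "x \<in> D" and v: "v \<in> V" for x v
  proof -
    obtain w where w: "w \<in> W" "v = matrix_inv h *v w" using v by (auto simp: V_def)
    have "matrix_inv h *v (\<rho>' x *v w) = (matrix_inv h ** h) ** \<rho> x ** matrix_inv h *v w"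
      by (simp add: \<rho>'[OF x] matrix_vector_mul_assoc matrix_mul_assoc)
    also have "\<dots> = \<rho> x *v v"
      using d by (simp add: matrix_inv_det w matrix_vector_mul_assoc)
    finally show ?thesis using W w x by (force simp: V_def)
  qed
  ultimately have "V = {0} \<or> V = UNIV"
    using irr unfolding irreducible_on_def by blast
  then show "W = {0} \<or> W = UNIV"
  proof
    assume "V = UNIV"
    have "w \<in> W" for w
      unfolding hV[symmetric] \<open>V = UNIV\<close> using d
      by (intro image_eqI[of _ _ "matrix_inv h *v w"]) (auto simp: matrix_vector_mul_assoc matrix_inv_det)
    then show ?thesis by blast
  qed (use hV in auto)
qed

section \<open>The marked surface group and the groups of its pairs of pants\<close>

locale marked_surface =
  fixes S :: "'a::t2_space set" and g :: nat and L :: "(real \<Rightarrow> 'a) set set" and M :: "'a marking"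
  assumes genus: "g \<ge> 2"
    and marked: "marked_pants_decomposition g S L M"
begin

abbreviation "G \<equiv> surface_group S M"

lemma group_G: "group G"
  using marked group_pi1 unfolding marked_pants_decomposition_def surface_generators_def by blast

lemma presentation: "presented_by G (surface_gens g) (surface_gen_val S M) (surface_relators g M)"
  using marked unfolding marked_pants_decomposition_def surface_generators_def by blast

text \<open>Presents \<open>pants_subgroup\<close> as a homomorphic image of the fundamental group
  of the pair of pants, so that induction over words in the boundary loops reaches all of its
  elements.\<close>

lemma pants_generated:
  assumes k: "k \<in> {1..2 * g - 2}"
  obtains \<Phi> where "group (pi1 (pants M k) (pants_pt M k))"
    "\<Phi> \<in> hom (pi1 (pants M k) (pants_pt M k)) G"
    "pants_subgroup S M k = \<Phi> ` carrier (pi1 (pants M k) (pants_pt M k))"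
    "\<And>e. \<Phi> (path_class (pants M k) (bdry_loop M k e)) = bdry_gen S M k e"
    "presented_by (pi1 (pants M k) (pants_pt M k)) UNIV
          (\<lambda>e. path_class (pants M k) (bdry_loop M k e)) {[(Delta, True), (Beta, True), (Alpha, True)]}"
proof -
  let ?Y = "pants M k" and ?y = "pants_pt M k" and ?p = "pants_path M k"
  have "?Y \<in> components (S - (\<Union>j\<in>{1..3 * g - 3}. path_image (curve M j)))"
    using marked k unfolding marked_pants_decomposition_def pants_decomposition_def bij_betw_def by blast
  then have YS: "?Y \<subseteq> S" using in_components_subset by blast
  have p: "path ?p" "path_image ?p \<subseteq> S" "pathstart ?p = basept M" "pathfinish ?p = ?y"
    using marked k unfolding marked_pants_decomposition_def surface_generators_def by blast+
  have y: "?y \<in> ?Y" and l: "\<And>e. bdry_loop M k e \<in> loops_at ?Y ?y"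
    and pres: "presented_by (pi1 ?Y ?y) UNIV
          (\<lambda>e. path_class ?Y (bdry_loop M k e)) {[(Delta, True), (Beta, True), (Alpha, True)]}"
    using marked k unfolding marked_pants_decomposition_def boundary_generators_def by blast+
  obtain \<Phi> where \<Phi>: "\<Phi> \<in> hom (pi1 ?Y ?y) G"
    "\<And>l. l \<in> loops_at ?Y ?y \<Longrightarrow> \<Phi> (path_class ?Y l) = transported S M k l"
    using conj_path_hom[OF p YS] unfolding transported_def by metis
  have "pants_subgroup S M k = \<Phi> ` carrier (pi1 ?Y ?y)"
    by (auto simp: pants_subgroup_def pi1_def \<Phi>(2) image_image)
  moreover have "\<Phi> (path_class ?Y (bdry_loop M k e)) = bdry_gen S M k e" for e
    by (simp add: \<Phi>(2) l bdry_gen_def)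
  ultimately show thesis using that group_pi1[OF y] \<Phi>(1) pres by blast
qed

lemma pants_subgroup_subset: "k \<in> {1..2 * g - 2} \<Longrightarrow> pants_subgroup S M k \<subseteq> carrier G"
  by (rule pants_generated) (auto simp: hom_def)

lemma bdry_gen_in_pants_subgroup:
  assumes "k \<in> {1..2 * g - 2}"
  shows "bdry_gen S M k e \<in> pants_subgroup S M k"
  using marked assms
  unfolding bdry_gen_def pants_subgroup_def marked_pants_decomposition_def boundary_generators_def by blast

lemma gens_in_carrier:
  "k \<in> {1..2 * g - 2} \<Longrightarrow> bdry_gen S M k e \<in> carrier G"
  "j \<in> {1..3 * g - 3} \<Longrightarrow> stable M j \<in> carrier G"
proof -
  have c: "surface_gen_val S M i \<in> carrier G" if "i \<in> surface_gens g" for i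
    using that presentation unfolding presented_by_def by blast
  show "bdry_gen S M k e \<in> carrier G" if "k \<in> {1..2 * g - 2}"
    using c[of "Bdry k e"] that by (simp add: surface_gens_def surface_gen_val_def)
  show "stable M j \<in> carrier G" if "j \<in> {1..3 * g - 3}"
    using c[of "Stable j"] that by (simp add: surface_gens_def surface_gen_val_def)
qed

lemma bdry_relation:
  assumes k: "k \<in> {1..2 * g - 2}"
  shows "bdry_gen S M k Delta = inv\<^bsub>G\<^esub> (bdry_gen S M k Beta \<otimes>\<^bsub>G\<^esub> bdry_gen S M k Alpha)"
proof -
  interpret group G by (rule group_G)
  have "word_val G (surface_gen_val S M) [(Bdry k Delta, True), (Bdry k Beta, True), (Bdry k Alpha, True)] = \<one>\<^bsub>G\<^esub>"
    by (rule presented_by_relator[OF presentation])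
      (use k in \<open>auto simp: surface_relators_def surface_gens_def\<close>)
  then have "bdry_gen S M k Delta \<otimes>\<^bsub>G\<^esub> (bdry_gen S M k Beta \<otimes>\<^bsub>G\<^esub> bdry_gen S M k Alpha) = \<one>\<^bsub>G\<^esub>"
    using gens_in_carrier(1)[OF k] by (simp add: surface_gen_val_def)
  then show ?thesis
    using gens_in_carrier(1)[OF k] by (metis inv_equality m_closed)
qed

lemma pants_hom_eqI:
  assumes k: "k \<in> {1..2 * g - 2}" and f: "f \<in> hom G SL3C" "f' \<in> hom G SL3C"
    and eq: "f (bdry_gen S M k Alpha) = f' (bdry_gen S M k Alpha)"
      "f (bdry_gen S M k Beta) = f' (bdry_gen S M k Beta)"
    and x: "x \<in> pants_subgroup S M k"
  shows "f x = f' x"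
proof -
  interpret f: group_hom G SL3C f
    using group_G group_SL3C f by (simp add: group_hom_def group_hom_axioms_def)
  interpret f': group_hom G SL3C f'
    using group_G group_SL3C f by (simp add: group_hom_def group_hom_axioms_def)
  have e: "f (bdry_gen S M k e) = f' (bdry_gen S M k e)" for e
    by (cases e) (use gens_in_carrier(1)[OF k] in \<open>simp_all add: eq bdry_relation[OF k]\<close>)
  let ?Y = "pi1 (pants M k) (pants_pt M k)"
  obtain \<Phi> where Y: "group ?Y" and \<Phi>: "\<Phi> \<in> hom ?Y G" "pants_subgroup S M k = \<Phi> ` carrier ?Y"
    "\<And>e. \<Phi> (path_class (pants M k) (bdry_loop M k e)) = bdry_gen S M k e"
    and pres: "presented_by ?Y UNIV (\<lambda>e. path_class (pants M k) (bdry_loop M k e))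
      {[(Delta, True), (Beta, True), (Alpha, True)]}"
    using pants_generated[OF k] by metis
  obtain z where z: "z \<in> carrier ?Y" "x = \<Phi> z" using x \<Phi>(2) by blast
  have "(f \<circ> \<Phi>) z = (f' \<circ> \<Phi>) z"
    by (rule presented_by_hom_eqI[OF Y group_SL3C hom_compose[OF \<Phi>(1) f(1)] hom_compose[OF \<Phi>(1) f(2)] pres])
      (use z \<Phi>(3) e in auto)
  then show ?thesis using z by simp
qed

text \<open>A subspace invariant under the images of \<open>Alpha\<close> and \<open>Beta\<close> is
  invariant under their inverses, hence under \<open>Delta\<close> and under every word in the
  boundary generators.\<close>

lemma irreducible_pair_bdry:
  assumes k: "k \<in> {1..2 * g - 2}" and f: "f \<in> hom G SL3C"
    and irr: "irreducible_on (pants_subgroup S M k) f"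
  shows "irreducible_pair (f (bdry_gen S M k Alpha)) (f (bdry_gen S M k Beta))"
  unfolding irreducible_pair_def
proof (intro allI impI)
  fix W :: "(complex^3) set"
  assume W: "vec.subspace W \<and> (\<forall>w\<in>W. f (bdry_gen S M k Alpha) *v w \<in> W \<and> f (bdry_gen S M k Beta) *v w \<in> W)"
  interpret f: group_hom G SL3C f
    using group_G group_SL3C f by (simp add: group_hom_def group_hom_axioms_def)
  note c = gens_in_carrier(1)[OF k]
  have d: "det (f x) = 1" if "x \<in> carrier G" for x
    using f.hom_closed[OF that] by (simp add: SL3C_def)
  have minv: "f (inv\<^bsub>G\<^esub> x) = matrix_inv (f x)" if "x \<in> carrier G" for x
    using that by (simp add: inv_SL3C)
  have mm: "f (x \<otimes>\<^bsub>G\<^esub> y) = f x ** f y" if "x \<in> carrier G" "y \<in> carrier G" for x y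
    using that by (simp add: SL3C_def)
  have I: "f (inv\<^bsub>G\<^esub> x) *v w \<in> W" if "x \<in> carrier G" "\<And>w. w \<in> W \<Longrightarrow> f x *v w \<in> W" "w \<in> W" for x w
    unfolding minv[OF that(1)]
    by (rule matrix_inv_invariant) (use that d W in auto)
  have e: "f (bdry_gen S M k e) *v w \<in> W" if "w \<in> W" for e w
  proof (cases e)
    case Delta
    show ?thesis
      unfolding Delta bdry_relation[OF k]
      by (rule I) (use c W that in \<open>auto simp: mm matrix_vector_mul_assoc[symmetric] simp del: f.hom_mult\<close>)
  qed (use W that in auto)
  let ?Y = "pi1 (pants M k) (pants_pt M k)"
  obtain \<Phi> where Y: "group ?Y" and \<Phi>: "\<Phi> \<in> hom ?Y G" "pants_subgroup S M k = \<Phi> ` carrier ?Y"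
    "\<And>e. \<Phi> (path_class (pants M k) (bdry_loop M k e)) = bdry_gen S M k e"
    and pres: "presented_by ?Y UNIV (\<lambda>e. path_class (pants M k) (bdry_loop M k e))
      {[(Delta, True), (Beta, True), (Alpha, True)]}"
    using pants_generated[OF k] by metis
  interpret \<Phi>: group_hom ?Y G \<Phi>
    using group_G Y \<Phi>(1) by (simp add: group_hom_def group_hom_axioms_def)
  have cY: "path_class (pants M k) (bdry_loop M k e) \<in> carrier ?Y" for e
    using pres by (auto simp: presented_by_def)
  have "\<forall>w\<in>W. f (\<Phi> z) *v w \<in> W" if "z \<in> carrier ?Y" for z
    using Y pres that
  proof (rule presented_by_induct)
    show "\<forall>w\<in>W. f (\<Phi> \<one>\<^bsub>?Y\<^esub>) *v w \<in> W"
      by (simp add: SL3C_def)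
  next
    fix i z assume "z \<in> carrier ?Y" "\<forall>w\<in>W. f (\<Phi> z) *v w \<in> W"
    then show "\<forall>w\<in>W. f (\<Phi> (path_class (pants M k) (bdry_loop M k i) \<otimes>\<^bsub>?Y\<^esub> z)) *v w \<in> W"
      using cY c e by (simp add: \<Phi>(3) mm matrix_vector_mul_assoc[symmetric] del: f.hom_mult)
  next
    fix i z assume "z \<in> carrier ?Y" "\<forall>w\<in>W. f (\<Phi> z) *v w \<in> W"
    then show "\<forall>w\<in>W. f (\<Phi> (inv\<^bsub>?Y\<^esub> path_class (pants M k) (bdry_loop M k i) \<otimes>\<^bsub>?Y\<^esub> z)) *v w \<in> W"
      using cY c I[OF c e] by (simp add: \<Phi>(3) mm matrix_vector_mul_assoc[symmetric] del: f.hom_mult f.hom_inv)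
  qed
  then show "W = {0} \<or> W = UNIV"
    using irr W unfolding irreducible_on_def \<Phi>(2) by blast
qed

section \<open>Real quasi-Fuchsian representations on the boundary generators\<close>

text \<open>Membership in \<open>Y_space\<close> concerns the conjugacy class, and its witness
  \<open>\<rho>1\<close> may be another representative. Strong loxodromy and irreducibility are
  carried back to \<open>\<rho>\<close> by the conjugation between them.\<close>

lemma QF_realD:
  assumes "\<rho> \<in> QF_real g S M"
  shows "\<rho> \<in> hom G SL3C" "\<And>x. x \<in> carrier G \<Longrightarrow> \<rho> x \<in> SL3R"
    "\<And>j. j \<in> {1..3 * g - 3} \<Longrightarrow> curve_gen S M j \<in> carrier G \<Longrightarrow> strongly_loxodromic (\<rho> (curve_gen S M j))"
    "\<And>k. k \<in> {1..2 * g - 2} \<Longrightarrow> irreducible_on (pants_subgroup S M k) \<rho>"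
proof -
  show hom: "\<rho> \<in> hom G SL3C" and "\<And>x. x \<in> carrier G \<Longrightarrow> \<rho> x \<in> SL3R"
    using assms by (auto simp: QF_real_def reps_into_def)
  have "conj_class S M \<rho> \<in> Y_space g S M"
    using assms by (simp add: QF_real_def Q_space_def)
  then obtain \<rho>1 where eq: "conj_class S M \<rho> = conj_class S M \<rho>1"
    and lox: "\<And>j. j \<in> {1..3 * g - 3} \<Longrightarrow> strongly_loxodromic (\<rho>1 (curve_gen S M j))"
    and irr: "\<And>k. k \<in> {1..2 * g - 2} \<Longrightarrow> irreducible_on (pants_subgroup S M k) \<rho>1"
    by (auto simp: Y_space_def)
  have "\<rho> \<in> conj_class S M \<rho>"
    unfolding conj_class_def conjugate_reps_def
    by (auto simp: SL3C_def intro!: exI[of _ "mat 1"] simp: matrix_inv_eqI[of "mat 1" "mat 1"])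
  then obtain h where h: "det h = 1" "\<And>x. x \<in> carrier G \<Longrightarrow> \<rho> x = h ** \<rho>1 x ** matrix_inv h"
    unfolding eq by (auto simp: conj_class_def conjugate_reps_def SL3C_def)
  show "strongly_loxodromic (\<rho> (curve_gen S M j))"
    if "j \<in> {1..3 * g - 3}" "curve_gen S M j \<in> carrier G" for j
    using h that lox strongly_loxodromic_conj[of "\<rho>1 (curve_gen S M j)" h] by simp
  show "irreducible_on (pants_subgroup S M k) \<rho>" if k: "k \<in> {1..2 * g - 2}" for k
    by (rule irreducible_on_conj[OF irr[OF k], of h]) (use h pants_subgroup_subset[OF k] in auto)
qed

lemma side_range:
  assumes "j \<in> {1..3 * g - 3}"
  shows "fst (side M j) \<in> {1..2 * g - 2}" "fst (side' M j) \<in> {1..2 * g - 2}"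
proof -
  have b: "bij_betw (\<lambda>(j, b). if b then side M j else side' M j)
       ({1..3 * g - 3} \<times> UNIV) ({1..2 * g - 2} \<times> UNIV)"
    using marked unfolding marked_pants_decomposition_def boundary_generators_def by blast
  from bij_betwE[OF b] assms
  have "(\<lambda>(j, b). if b then side M j else side' M j) (j, True) \<in> {1..2 * g - 2} \<times> UNIV"
    "(\<lambda>(j, b). if b then side M j else side' M j) (j, False) \<in> {1..2 * g - 2} \<times> UNIV"
    by blast+
  then show "fst (side M j) \<in> {1..2 * g - 2}" "fst (side' M j) \<in> {1..2 * g - 2}"
    by (auto simp: mem_Times_iff)
qed

lemma curve_gen_in_carrier: "j \<in> {1..3 * g - 3} \<Longrightarrow> curve_gen S M j \<in> carrier G"
  using side_range(1) gens_in_carrier(1) by (simp add: curve_gen_def split: prod.split) (metis fst_conv)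

text \<open>Every boundary label occurs as a side of some curve. Claims about boundary generators
  thus reduce to curve generators, on the first side, and to conjugates of their inverses, on the
  second.\<close>

lemma side_cases:
  assumes "k \<in> {1..2 * g - 2}"
  obtains j where "j \<in> {1..3 * g - 3}" "side M j = (k, e)" | j where "j \<in> {1..3 * g - 3}" "side' M j = (k, e)"
proof -
  have b: "bij_betw (\<lambda>(j, b). if b then side M j else side' M j)
       ({1..3 * g - 3} \<times> UNIV) ({1..2 * g - 2} \<times> UNIV)"
    using marked unfolding marked_pants_decomposition_def boundary_generators_def by blast
  have "(k, e) \<in> {1..2 * g - 2} \<times> UNIV" using assms by simp
  then have "(k, e) \<in> (\<lambda>(j, b). if b then side M j else side' M j) ` ({1..3 * g - 3} \<times> UNIV)"
    using b unfolding bij_betw_def by metis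
  then show thesis using that by (auto split: if_splits)
qed

lemma side'_gen:
  assumes j: "j \<in> {1..3 * g - 3}" and s: "side' M j = (k, e)"
  shows "bdry_gen S M k e = stable M j \<otimes>\<^bsub>G\<^esub> inv\<^bsub>G\<^esub> (curve_gen S M j) \<otimes>\<^bsub>G\<^esub> inv\<^bsub>G\<^esub> (stable M j)"
proof -
  interpret group G by (rule group_G)
  obtain k1 e1 where s1: "side M j = (k1, e1)" by (cases "side M j")
  have k: "k \<in> {1..2 * g - 2}" "k1 \<in> {1..2 * g - 2}" using side_range[OF j] s s1 by auto
  have "word_val G (surface_gen_val S M) [(case_prod Bdry (side' M j), True), (Stable j, True),
       (case_prod Bdry (side M j), True), (Stable j, False)] = \<one>\<^bsub>G\<^esub>"
    by (rule presented_by_relator[OF presentation])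
      (use j k s s1 in \<open>auto simp: surface_relators_def surface_gens_def\<close>)
  then have r: "bdry_gen S M k e \<otimes>\<^bsub>G\<^esub> (stable M j \<otimes>\<^bsub>G\<^esub> (curve_gen S M j \<otimes>\<^bsub>G\<^esub> inv\<^bsub>G\<^esub> (stable M j))) = \<one>\<^bsub>G\<^esub>"
    using gens_in_carrier(2)[OF j] s s1 by (simp add: surface_gen_val_def curve_gen_def)
  note c = gens_in_carrier(1)[OF k(1)] gens_in_carrier(2)[OF j] curve_gen_in_carrier[OF j]
  have "bdry_gen S M k e = inv\<^bsub>G\<^esub> (stable M j \<otimes>\<^bsub>G\<^esub> (curve_gen S M j \<otimes>\<^bsub>G\<^esub> inv\<^bsub>G\<^esub> (stable M j)))"
    by (rule inv_equality[symmetric]) (use r c in auto)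
  also have "\<dots> = stable M j \<otimes>\<^bsub>G\<^esub> inv\<^bsub>G\<^esub> (curve_gen S M j) \<otimes>\<^bsub>G\<^esub> inv\<^bsub>G\<^esub> (stable M j)"
    using c by (simp add: inv_mult_group)
  finally show ?thesis .
qed

lemma SL3C_rep:
  assumes f: "f \<in> hom G SL3C"
  shows "x \<in> carrier G \<Longrightarrow> det (f x) = 1"
    "x \<in> carrier G \<Longrightarrow> y \<in> carrier G \<Longrightarrow> f (x \<otimes>\<^bsub>G\<^esub> y) = f x ** f y"
    "x \<in> carrier G \<Longrightarrow> f (inv\<^bsub>G\<^esub> x) = matrix_inv (f x)"
    "f \<one>\<^bsub>G\<^esub> = mat 1"
proof -
  interpret f: group_hom G SL3C f
    using group_G group_SL3C f by (simp add: group_hom_def group_hom_axioms_def)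
  show "x \<in> carrier G \<Longrightarrow> det (f x) = 1"
    using f.hom_closed[of x] by (simp add: SL3C_def)
  show "x \<in> carrier G \<Longrightarrow> y \<in> carrier G \<Longrightarrow> f (x \<otimes>\<^bsub>G\<^esub> y) = f x ** f y"
    by (simp add: SL3C_def)
  show "x \<in> carrier G \<Longrightarrow> f (inv\<^bsub>G\<^esub> x) = matrix_inv (f x)"
    by (simp add: inv_SL3C)
  show "f \<one>\<^bsub>G\<^esub> = mat 1"
    by (simp add: SL3C_def)
qed

lemma side'_rep:
  assumes f: "f \<in> hom G SL3C" and j: "j \<in> {1..3 * g - 3}" and s: "side' M j = (k, e)"
  shows "f (bdry_gen S M k e) = f (stable M j) ** matrix_inv (f (curve_gen S M j)) ** matrix_inv (f (stable M j))"
proof -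
  interpret group G by (rule group_G)
  show ?thesis
    using gens_in_carrier(2)[OF j] curve_gen_in_carrier[OF j]
    by (simp add: side'_gen[OF j s] SL3C_rep[OF f])
qed

lemma bdry_strongly_loxodromic:
  assumes \<rho>: "\<rho> \<in> QF_real g S M" and k: "k \<in> {1..2 * g - 2}"
  shows "strongly_loxodromic (\<rho> (bdry_gen S M k e))"
  using k
proof (cases rule: side_cases[where e = e])
  case (1 j)
  then show ?thesis
    using QF_realD(3)[OF \<rho> 1(1) curve_gen_in_carrier[OF 1(1)]] by (simp add: curve_gen_def)
next
  case (2 j)
  note c = curve_gen_in_carrier[OF 2(1)] gens_in_carrier(2)[OF 2(1)]
  show ?thesis
    unfolding side'_rep[OF QF_realD(1)[OF \<rho>] 2]
    by (intro strongly_loxodromic_conj strongly_loxodromic_inv QF_realD(3)[OF \<rho> 2(1)] c)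
      (use c SL3C_rep(1)[OF QF_realD(1)[OF \<rho>]] in auto)
qed

text \<open>On a first side the traces are those of the curve. On a second side the generator maps
  to a conjugate of the inverse, so the two traces are exchanged.\<close>

lemma bdry_traces:
  assumes \<rho>: "\<rho> \<in> hom G SL3C" and \<rho>': "\<rho>' \<in> hom G SL3C"
    and tr: "trace_data g S M \<rho> = trace_data g S M \<rho>'" and k: "k \<in> {1..2 * g - 2}"
  shows "trace (\<rho> (bdry_gen S M k e)) = trace (\<rho>' (bdry_gen S M k e)) \<and>
    trace (matrix_inv (\<rho> (bdry_gen S M k e))) = trace (matrix_inv (\<rho>' (bdry_gen S M k e)))"
proof -
  have t: "trace (\<rho> (curve_gen S M j)) = trace (\<rho>' (curve_gen S M j))"
    "trace (matrix_inv (\<rho> (curve_gen S M j))) = trace (matrix_inv (\<rho>' (curve_gen S M j)))"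
    if "j \<in> {1..3 * g - 3}" for j
    using fun_cong[OF tr, of j] that by (simp_all add: trace_data_def)
  from k show ?thesis
  proof (cases rule: side_cases[where e = e])
    case (1 j)
    then show ?thesis using t[OF 1(1)] by (simp add: curve_gen_def)
  next
    case (2 j)
    note c = curve_gen_in_carrier[OF 2(1)] gens_in_carrier(2)[OF 2(1)]
    have "trace (f (bdry_gen S M k e)) = trace (matrix_inv (f (curve_gen S M j))) \<and>
      trace (matrix_inv (f (bdry_gen S M k e))) = trace (f (curve_gen S M j))"
      if f: "f \<in> hom G SL3C" for f
    proof -
      have d: "det (f (curve_gen S M j)) \<noteq> 0" "det (f (stable M j)) \<noteq> 0"
        using c SL3C_rep(1)[OF f] by auto
      then have d': "det (matrix_inv (f (curve_gen S M j))) \<noteq> 0" "det (matrix_inv (f (stable M j))) \<noteq> 0"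
        by (simp_all add: det_matrix_inv)
      have "trace (f (stable M j) ** X ** matrix_inv (f (stable M j))) = trace X" for X
        using trace_conj[OF d'(2), of X] by (simp add: matrix_inv_inv d)
      then show ?thesis
        unfolding side'_rep[OF f 2]
        using d d' by (simp add: matrix_inv_mul matrix_inv_inv det_mul matrix_mul_assoc)
    qed
    then show ?thesis using t[OF 2(1)] \<rho> \<rho>' by simp
  qed
qed

section \<open>Real conjugation on each pair of pants\<close>

text \<open>The data supply the nine traces for \<open>irreducible_pair_determined\<close>: the
  curve traces give those of \<open>A\<close>, \<open>B\<close>, \<open>A B\<close> and the
  inverses, the shape invariants give the two mixed ones, and the root is the commutator trace. The
  resulting complex intertwiner is then replaced by a real one.\<close>

lemma pants_conjugate:
  assumes \<rho>: "\<rho> \<in> QF_real g S M" and \<rho>': "\<rho>' \<in> QF_real g S M"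
    and data: "pants_data g S M \<rho> = pants_data g S M \<rho>'" and k: "k \<in> {1..2 * g - 2}"
  obtains h where "h \<in> SL3R" "\<forall>x\<in>pants_subgroup S M k. \<rho>' x = h ** \<rho> x ** matrix_inv h"
proof -
  define A B A' B' where AB: "A = \<rho> (bdry_gen S M k Alpha)" "B = \<rho> (bdry_gen S M k Beta)"
    "A' = \<rho>' (bdry_gen S M k Alpha)" "B' = \<rho>' (bdry_gen S M k Beta)"
  have data: "trace_data g S M \<rho> = trace_data g S M \<rho>'" "shape_data g S M \<rho> = shape_data g S M \<rho>'"
    "root_data g S M \<rho> = root_data g S M \<rho>'"
    using data by (auto simp: pants_data_def)
  note hom = QF_realD(1)[OF \<rho>] QF_realD(1)[OF \<rho>']
  note c = gens_in_carrier(1)[OF k]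
  have d: "det A = 1" "det B = 1" "det A' = 1" "det B' = 1"
    using c by (simp_all add: AB SL3C_rep(1)[OF hom(1)] SL3C_rep(1)[OF hom(2)])
  have lox: "strongly_loxodromic A" "strongly_loxodromic A'"
    using bdry_strongly_loxodromic k \<rho> \<rho>' by (auto simp: AB)
  have irr: "irreducible_pair A B" "irreducible_pair A' B'"
    unfolding AB using k hom QF_realD(4)[OF \<rho> k] QF_realD(4)[OF \<rho>' k]
    by (auto intro!: irreducible_pair_bdry)
  have t: "trace A = trace A'" "trace (matrix_inv A) = trace (matrix_inv A')"
    "trace B = trace B'" "trace (matrix_inv B) = trace (matrix_inv B')"
    unfolding AB using bdry_traces[OF hom data(1) k] by auto
  have D: "f (bdry_gen S M k Delta) = matrix_inv (f (bdry_gen S M k Beta) ** f (bdry_gen S M k Alpha))"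
    if f: "f \<in> hom G SL3C" for f
  proof -
    interpret group G by (rule group_G)
    show ?thesis using c by (simp add: bdry_relation[OF k] SL3C_rep[OF f])
  qed
  \<comment> \<open>The third boundary generator maps to the inverse of \<open>B A\<close>;
    cyclicity of the trace turns this into information on \<open>A B\<close>.\<close>
  have "trace (matrix_inv (B ** A)) = trace (matrix_inv (B' ** A'))"
    "trace (matrix_inv (matrix_inv (B ** A))) = trace (matrix_inv (matrix_inv (B' ** A')))"
    unfolding AB using bdry_traces[OF hom data(1) k, of Delta] D[OF hom(1)] D[OF hom(2)] by auto
  then have t2: "trace (matrix_inv A ** matrix_inv B) = trace (matrix_inv A' ** matrix_inv B')"
    "trace (A ** B) = trace (A' ** B')"
    using d by (simp_all add: matrix_inv_mul matrix_inv_inv det_mul det_matrix_inv trace_mul_sym[of A B] trace_mul_sym[of A' B'])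
  have "shape A B = shape A' B'" "shape B A = shape B' A'"
    using fun_cong[OF data(2), of k] k by (simp_all add: shape_data_def AB)
  \<comment> \<open>The product terms in the shape invariants involve single traces known from
    \<open>t\<close>, so the mixed traces can be solved for.\<close>
  then have t3: "trace (matrix_inv A ** B) = trace (matrix_inv A' ** B')"
    "trace (A ** matrix_inv B) = trace (A' ** matrix_inv B')"
    using t by (simp_all add: shape_def trace_mul_sym[of A "matrix_inv B"] trace_mul_sym[of A' "matrix_inv B'"])
  have t4: "trace (commutator A B) = trace (commutator A' B')"
    using fun_cong[OF data(3), of k] k by (simp add: root_data_def AB)
  obtain h0 where h0: "det h0 \<noteq> 0" "A' ** h0 = h0 ** A" "B' ** h0 = h0 ** B"
    using irreducible_pair_determined[OF d lox irr t t2(2,1) t3 t4] by metis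
  \<comment> \<open>Indexing the two generators by a boolean makes one real matrix intertwine both
    at once.\<close>
  define X X' where "X = (\<lambda>b. if b then A else B)" and "X' = (\<lambda>b. if b then A' else B')"
  have re: "real_entries (X b)" "real_entries (X' b)" for b
    using c QF_realD(2)[OF \<rho>] QF_realD(2)[OF \<rho>'] by (auto simp: X_def X'_def AB SL3R_def)
  obtain h where h: "h \<in> SL3R" "\<And>b. X' b ** h = h ** X b"
    using real_intertwiner[of h0 UNIV X' X] h0 re by (metis UNIV_I X_def X'_def)
  then have dh: "det h = 1" by (simp add: SL3R_def)
  have e: "A' = h ** A ** matrix_inv h" "B' = h ** B ** matrix_inv h"
    using h(2)[of True] h(2)[of False] dh by (simp_all add: conj_eq_iff X_def X'_def)
  have "\<rho>' x = h ** \<rho> x ** matrix_inv h" if x: "x \<in> pants_subgroup S M k" for x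
    using pants_hom_eqI[OF k hom(2) conj_in_hom_SL3C[OF hom(1) dh]] e x
    unfolding AB by blast
  then have "\<forall>x\<in>pants_subgroup S M k. \<rho>' x = h ** \<rho> x ** matrix_inv h" by blast
  with h(1) show thesis by (rule that)
qed

lemma pants_conjugator_properties:
  assumes "\<rho> \<in> QF_real g S M" "\<rho>' \<in> QF_real g S M"
    and "pants_data g S M \<rho> = pants_data g S M \<rho>'" "k \<in> {1..2 * g - 2}"
  shows "pants_conjugator S M \<rho> \<rho>' k \<in> SL3R"
    "\<And>x. x \<in> pants_subgroup S M k \<Longrightarrow>
       \<rho>' x = pants_conjugator S M \<rho> \<rho>' k ** \<rho> x ** matrix_inv (pants_conjugator S M \<rho> \<rho>' k)"
proof -
  have "\<exists>h. h \<in> SL3R \<and> (\<forall>x\<in>pants_subgroup S M k. \<rho>' x = h ** \<rho> x ** matrix_inv h)"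
    using pants_conjugate[OF assms] by metis
  from someI_ex[OF this] show "pants_conjugator S M \<rho> \<rho>' k \<in> SL3R"
    "\<And>x. x \<in> pants_subgroup S M k \<Longrightarrow>
       \<rho>' x = pants_conjugator S M \<rho> \<rho>' k ** \<rho> x ** matrix_inv (pants_conjugator S M \<rho> \<rho>' k)"
    unfolding pants_conjugator_def[symmetric] by auto
qed

section \<open>Gluing along the curves\<close>

lemma tree_stable:
  assumes "j \<in> tree M"
  shows "j \<in> {1..3 * g - 3}" "stable M j = \<one>\<^bsub>G\<^esub>"
proof -
  interpret group G by (rule group_G)
  show j: "j \<in> {1..3 * g - 3}"
    using assms marked
    unfolding marked_pants_decomposition_def surface_generators_def spanning_tree_def by blast
  have "word_val G (surface_gen_val S M) [(Stable j, True)] = \<one>\<^bsub>G\<^esub>"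
    by (rule presented_by_relator[OF presentation])
      (use assms j in \<open>auto simp: surface_relators_def surface_gens_def\<close>)
  then show "stable M j = \<one>\<^bsub>G\<^esub>"
    using gens_in_carrier(2)[OF j] by (simp add: surface_gen_val_def)
qed

lemma conjugate_if_same_gluing:
  assumes \<rho>0: "\<rho>0 \<in> hom G SL3C" and \<rho>: "\<rho> \<in> hom G SL3C" and \<rho>': "\<rho>' \<in> hom G SL3C"
    and h: "\<And>k. k \<in> {1..2 * g - 2} \<Longrightarrow> det (pants_conjugator S M \<rho>0 \<rho> k) = 1"
      "\<And>k x. k \<in> {1..2 * g - 2} \<Longrightarrow> x \<in> pants_subgroup S M k \<Longrightarrow>
       \<rho> x = pants_conjugator S M \<rho>0 \<rho> k ** \<rho>0 x ** matrix_inv (pants_conjugator S M \<rho>0 \<rho> k)"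
    and h': "\<And>k. k \<in> {1..2 * g - 2} \<Longrightarrow> det (pants_conjugator S M \<rho>0 \<rho>' k) = 1"
      "\<And>k x. k \<in> {1..2 * g - 2} \<Longrightarrow> x \<in> pants_subgroup S M k \<Longrightarrow>
       \<rho>' x = pants_conjugator S M \<rho>0 \<rho>' k ** \<rho>0 x ** matrix_inv (pants_conjugator S M \<rho>0 \<rho>' k)"
    and glue: "\<And>j. j \<in> {1..3 * g - 3} \<Longrightarrow> gluing_matrix S M \<rho>0 \<rho> j = gluing_matrix S M \<rho>0 \<rho>' j"
  shows "conjugate_reps S M \<rho> \<rho>'"
proof -
  define p p' where p: "p = pants_conjugator S M \<rho>0 \<rho>" "p' = pants_conjugator S M \<rho>0 \<rho>'"
  note h = h[folded p] and h' = h'[folded p]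
  \<comment> \<open>On the \<open>k\<close>-th pair of pants, \<open>m k\<close> conjugates
    \<open>\<rho>\<close> to \<open>\<rho>'\<close> by passing through
    \<open>\<rho>0\<close>.\<close>
  define m where "m = (\<lambda>k. p' k ** matrix_inv (p k))"
  have p'm: "p' k = m k ** p k" if "k \<in> {1..2 * g - 2}" for k
    using h(1)[OF that] by (simp add: m_def matrix_mul_assoc[symmetric] matrix_inv_det)
  have dm: "det (m k) = 1" if "k \<in> {1..2 * g - 2}" for k
    using h(1)[OF that] h'(1)[OF that] by (simp add: m_def det_mul det_matrix_inv)
  \<comment> \<open>For a tree edge from \<open>a\<close> to \<open>b\<close>, equal gluing matrices
    say that the inverse of \<open>p a\<close> times \<open>p b\<close> equals the inverse of
    \<open>p' a\<close> times \<open>p' b\<close>. Multiplying by \<open>p' a\<close> on the left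
    and the inverse of \<open>p b\<close> on the right gives \<open>m b = m a\<close>.\<close>
  have edge: "m (fst (side M j)) = m (fst (side' M j))" if j: "j \<in> tree M" for j
  proof -
    define a b where ab: "a = fst (side M j)" "b = fst (side' M j)"
    have k: "a \<in> {1..2 * g - 2}" "b \<in> {1..2 * g - 2}"
      using side_range[OF tree_stable(1)[OF j]] by (auto simp: ab)
    have "matrix_inv (p a) ** p b = matrix_inv (p' a) ** p' b"
      using glue[OF tree_stable(1)[OF j]] j by (simp add: gluing_matrix_def p ab)
    then have "p' a ** (matrix_inv (p a) ** p b) ** matrix_inv (p b)
        = p' a ** (matrix_inv (p' a) ** p' b) ** matrix_inv (p b)" by simp
    moreover have "p' a ** (matrix_inv (p a) ** p b) ** matrix_inv (p b)
        = p' a ** matrix_inv (p a) ** (p b ** matrix_inv (p b))"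
      by (simp only: matrix_mul_assoc)
    moreover have "p' a ** (matrix_inv (p' a) ** p' b) ** matrix_inv (p b) =
        (p' a ** matrix_inv (p' a)) ** p' b ** matrix_inv (p b)"
      by (simp only: matrix_mul_assoc)
    ultimately show ?thesis
      using h(1)[OF k(2)] h'(1)[OF k(1)] by (simp add: matrix_inv_det m_def ab)
  qed
  have conn: "m k = m k'" if "joined_via M (tree M) k k'" for k k'
    using that unfolding joined_via_def
  proof (induction rule: rtranclp_induct)
    case (step y z)
    then show ?case using edge unfolding adjacent_via_def by (auto simp: doubleton_eq_iff)
  qed simp
  \<comment> \<open>The first pair of pants serves as the base vertex; it exists because the genus
    is at least two.\<close>
  have one: "1 \<in> {1..2 * g - 2}" using genus by auto
  have mk: "m k = m 1" if "k \<in> {1..2 * g - 2}" for k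
    using conn marked that one
    unfolding marked_pants_decomposition_def surface_generators_def spanning_tree_def by blast
  define n where "n = m 1"
  have dn: "det n = 1" using dm[OF one] by (simp add: n_def)
  have pn: "p' k = n ** p k" if "k \<in> {1..2 * g - 2}" for k
    using p'm[OF that] mk[OF that] by (simp add: n_def)
  have B: "\<rho>' x = n ** \<rho> x ** matrix_inv n" if k: "k \<in> {1..2 * g - 2}" and x: "x \<in> pants_subgroup S M k" for k x
    using h(1)[OF k] dn
    by (simp add: h(2)[OF k x] h'(2)[OF k x] pn[OF k] matrix_inv_mul matrix_mul_assoc)
  have D: "\<rho>' (stable M j) = n ** \<rho> (stable M j) ** matrix_inv n" if j: "j \<in> {1..3 * g - 3}" for j
  proof (cases "j \<in> tree M")
    case True
    then show ?thesis
      using dn by (simp add: tree_stable SL3C_rep(4)[OF \<rho>] SL3C_rep(4)[OF \<rho>'] matrix_inv_det)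
  next
    case False
    define a b d where abd: "a = fst (side M j)" "b = fst (side' M j)" "d = stable M j"
    have k: "a \<in> {1..2 * g - 2}" "b \<in> {1..2 * g - 2}"
      using side_range[OF j] by (auto simp: abd)
    have d0: "det (\<rho>0 d) = 1" using SL3C_rep(1)[OF \<rho>0] gens_in_carrier(2)[OF j] by (simp add: abd)
    have da: "det (p a) = 1" and db: "det (p b) = 1" using h(1) k by auto
    have "matrix_inv (\<rho>0 d) ** (matrix_inv (p b) ** \<rho> d ** p a) =
        matrix_inv (\<rho>0 d) ** (matrix_inv (p' b) ** \<rho>' d ** p' a)"
      using glue[OF j] False by (simp add: gluing_matrix_def p abd)
    then have "\<rho>0 d ** (matrix_inv (\<rho>0 d) ** (matrix_inv (p b) ** \<rho> d ** p a)) =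
        \<rho>0 d ** (matrix_inv (\<rho>0 d) ** (matrix_inv (p' b) ** \<rho>' d ** p' a))" by simp
    then have "matrix_inv (p b) ** \<rho> d ** p a = matrix_inv (p' b) ** \<rho>' d ** p' a"
      using d0 by (simp add: matrix_mul_assoc matrix_inv_det)
    \<comment> \<open>Substituting \<open>n\<close> times \<open>p\<close> for \<open>p'\<close>
      leaves the same outer factors on both sides. Cancelling them shows that \<open>n\<close>
      conjugates \<open>\<rho> d\<close> to \<open>\<rho>' d\<close>.\<close>
    also have "\<dots> = matrix_inv (p b) ** (matrix_inv n ** \<rho>' d ** n) ** p a"
      using db dn by (simp add: pn[OF k(1)] pn[OF k(2)] matrix_inv_mul matrix_mul_assoc)
    finally have "p b ** (matrix_inv (p b) ** \<rho> d ** p a) ** matrix_inv (p a) =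
       p b ** (matrix_inv (p b) ** (matrix_inv n ** \<rho>' d ** n) ** p a) ** matrix_inv (p a)" by simp
    moreover have "p b ** (matrix_inv (p b) ** X ** p a) ** matrix_inv (p a) = X" for X
    proof -
      have "p b ** (matrix_inv (p b) ** X ** p a) ** matrix_inv (p a) =
        (p b ** matrix_inv (p b)) ** X ** (p a ** matrix_inv (p a))" by (simp only: matrix_mul_assoc)
      then show ?thesis using da db by (simp add: matrix_inv_det)
    qed
    ultimately have "\<rho> d = matrix_inv n ** \<rho>' d ** n" by simp
    then have "n ** \<rho> d ** matrix_inv n = (n ** matrix_inv n) ** \<rho>' d ** (n ** matrix_inv n)"
      by (simp only: matrix_mul_assoc)
    then show ?thesis using dn by (simp add: matrix_inv_det abd)
  qed
  \<comment> \<open>Both sides are homomorphisms, and \<open>B\<close> and \<open>D\<close> compare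
    them on the boundary and stable generators.\<close>
  have "\<rho>' x = n ** \<rho> x ** matrix_inv n" if "x \<in> carrier G" for x
  proof (rule presented_by_hom_eqI[OF group_G group_SL3C \<rho>' conj_in_hom_SL3C[OF \<rho> dn] presentation _ that])
    fix i assume "i \<in> surface_gens g"
    then show "\<rho>' (surface_gen_val S M i) = n ** \<rho> (surface_gen_val S M i) ** matrix_inv n"
      using B D bdry_gen_in_pants_subgroup by (auto simp: surface_gens_def surface_gen_val_def)
  qed
  then show ?thesis
    using dn unfolding conjugate_reps_def by (auto simp: SL3C_def)
qed

end

theorem theorem2p9:
  fixes S :: "'a::t2_space set" and g :: nat
    and L :: "(real \<Rightarrow> 'a) set set" and M :: "'a marking"
    and ref :: "pants_data \<Rightarrow> 'a rep" and \<rho> \<rho>' :: "'a rep" and t s :: "nat \<Rightarrow> real"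
  assumes "g \<ge> 2"
    and "closed_oriented_surface g S"
    and "curve_system S L"
    and "marked_pants_decomposition g S L M"
    and "reference_choice g S M ref"
    and "\<rho> \<in> QF_real g S M" and "\<rho>' \<in> QF_real g S M"
    and "trace_data g S M \<rho> = trace_data g S M \<rho>'"
    and "shape_data g S M \<rho> = shape_data g S M \<rho>'"
    and "root_data g S M \<rho> = root_data g S M \<rho>'"
    and "\<forall>j\<in>{1..3 * g - 3}. has_twist_bulge S M (ref (pants_data g S M \<rho>)) \<rho> j (t j) (s j)"
    and "\<forall>j\<in>{1..3 * g - 3}. has_twist_bulge S M (ref (pants_data g S M \<rho>')) \<rho>' j (t j) (s j)"
  shows "conjugate_reps S M \<rho> \<rho>'"
proof -
  interpret marked_surface S g L M by unfold_locales fact+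
  have data: "pants_data g S M \<rho> = pants_data g S M \<rho>'"
    using assms(8-10) by (simp add: pants_data_def)
  \<comment> \<open>Equal data select the same reference, so the twists and bulges of
    \<open>\<rho>\<close> and \<open>\<rho>'\<close> are measured against one
    representation.\<close>
  define \<rho>0 where "\<rho>0 = ref (pants_data g S M \<rho>)"
  have \<rho>0: "\<rho>0 \<in> QF_real g S M" "pants_data g S M \<rho>0 = pants_data g S M \<rho>"
    using assms(5,6) unfolding \<rho>0_def reference_choice_def by blast+
  show ?thesis
  proof (rule conjugate_if_same_gluing)
    show "\<rho>0 \<in> hom G SL3C" "\<rho> \<in> hom G SL3C" "\<rho>' \<in> hom G SL3C"
      using QF_realD(1) \<rho>0(1) assms(6,7) by blast+
    \<comment> \<open>Equal twist and bulge prescribe the same three eigenvalues along the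
      eigenlines of the same \<open>\<rho>0 (curve_gen S M j)\<close>.\<close>
    show "gluing_matrix S M \<rho>0 \<rho> j = gluing_matrix S M \<rho>0 \<rho>' j" if "j \<in> {1..3 * g - 3}" for j
      using assms(11,12) that
      unfolding has_twist_bulge_def has_twist_bend_bulge_turn_def Let_def data[symmetric] \<rho>0_def[symmetric]
      by (blast intro: eigenvalues_along_unique)
  qed (use pants_conjugator_properties[OF \<rho>0(1) assms(6) \<rho>0(2)]
        pants_conjugator_properties[OF \<rho>0(1) assms(7) \<rho>0(2)[unfolded data]] in \<open>auto simp: SL3R_def\<close>)
qed

end
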